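(* Let $H$ be a real Hilbert space and $A$ a strictly positive selfadjoint operator on $H$, with $\lambda_1>0$ the minimum of the spectrum of $A$. Let $\alpha,\beta,\gamma,\kappa>0$ with $\mu:=\gamma-\alpha\beta\ge0$, and let $\eta\in\mathbb R$ satisfy $$\eta^2>\mathfrak t(\kappa)\,\mu,\qquad \mathfrak t(\kappa)=\begin{cases}\dfrac{2\kappa}{\alpha^2}\Big(1-\dfrac{\alpha}{\kappa\lambda_1}+\dfrac{\alpha^2}{\kappa^2\lambda_1^2}\Big)&\text{if }\kappa<\alpha/\lambda_1,\\[2mm] \dfrac{2\kappa}{\alpha^2}&\text{if }\kappa\ge\alpha/\lambda_1.\end{cases}$$ Then the semigroup $S(t)$ on $\mathcal H$ generated by $$u_{ttt}+\alpha u_{tt}+\beta A u_t+\gamma A u=\eta A\theta,\qquad \theta_t+\kappa A\theta=-\eta A u_{tt}-\alpha\eta A u_t$$ is exponentially stable: there exist constants $\omega>0$ and $M\ge1$, independent of the initial data, such that $\mathcal E(t)\le M\mathcal E(0)e^{-\omega t}$ for all $t\ge0$ and every initial datum in $\mathcal H$.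
   Context: $H^\sigma=\mathcal D(A^{\sigma/2})$ with $\|u\|_\sigma=\|A^{\sigma/2}u\|$; $\mathcal H=H^1\times H^1\times H\times H$. The system, with initial data $(u(0),u_t(0),u_{tt}(0),\theta(0))\in\mathcal H$, generates a strongly continuous semigroup $S(t)$ on $\mathcal H$ via its unique weak solutions, and the energy of a solution is $\mathcal E(t)=\frac12\big[\|u_t+\alpha u\|_1^2+\|u_{tt}+\alpha u_t\|^2+\|u_t\|_1^2+\|\theta\|^2\big](t)$. *)

theory Defs
  imports "HOL-Analysis.Analysis"
begin

text \<open>An (unbounded) operator on a real Hilbert space is represented by a pair
  (domain D, map A); the values of A outside D are irrelevant.\<close>

definition linear_on :: "'h::real_vector set \<Rightarrow> ('h \<Rightarrow> 'h) \<Rightarrow> bool" where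
  "linear_on D A \<longleftrightarrow>
     (\<forall>x\<in>D. \<forall>y\<in>D. A (x + y) = A x + A y) \<and> (\<forall>c. \<forall>x\<in>D. A (c *\<^sub>R x) = c *\<^sub>R A x)"

definition selfadjoint_op :: "'h::real_inner set \<Rightarrow> ('h \<Rightarrow> 'h) \<Rightarrow> bool" where
  "selfadjoint_op D A \<longleftrightarrow>
     subspace D \<and> closure D = UNIV \<and> linear_on D A \<and>
     (\<forall>x\<in>D. \<forall>y\<in>D. A x \<bullet> y = x \<bullet> A y) \<and>
     (\<forall>y z. (\<forall>x\<in>D. A x \<bullet> y = x \<bullet> z) \<longrightarrow> y \<in> D \<and> A y = z)"

definition op_spectrum :: "'h::real_normed_vector set \<Rightarrow> ('h \<Rightarrow> 'h) \<Rightarrow> real set" where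
  "op_spectrum D A = {l. \<not> (bij_betw (\<lambda>x. A x - l *\<^sub>R x) D UNIV \<and>
                               (\<exists>C. \<forall>x\<in>D. norm x \<le> C * norm (A x - l *\<^sub>R x)))}"

text \<open>(DB, B) is the square root A^{1/2}: the nonnegative selfadjoint operator with B o B = A
  (unique, so quantifying over it is the same as fixing it).\<close>
definition is_sqrt_op :: "'h::real_inner set \<Rightarrow> ('h \<Rightarrow> 'h) \<Rightarrow> 'h set \<Rightarrow> ('h \<Rightarrow> 'h) \<Rightarrow> bool" where
  "is_sqrt_op D A DB B \<longleftrightarrow>
     selfadjoint_op DB B \<and> (\<forall>x\<in>DB. 0 \<le> B x \<bullet> x) \<and>
     D = {x \<in> DB. B x \<in> DB} \<and> (\<forall>x\<in>D. B (B x) = A x)"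

definition tfun :: "real \<Rightarrow> real \<Rightarrow> real \<Rightarrow> real" where
  "tfun \<alpha> lam1 \<kappa> =
     (if \<kappa> < \<alpha> / lam1
      then 2 * \<kappa> / \<alpha>\<^sup>2 * (1 - \<alpha> / (\<kappa> * lam1) + \<alpha>\<^sup>2 / (\<kappa>\<^sup>2 * lam1\<^sup>2))
      else 2 * \<kappa> / \<alpha>\<^sup>2)"

text \<open>Weak solution on [0,\<infinity>) of
  u_ttt + \<alpha> u_tt + \<beta> A u_t + \<gamma> A u = \<eta> A \<theta>,  \<theta>_t + \<kappa> A \<theta> = -\<eta> A u_tt - \<alpha>\<eta> A u_t,
  with (u, u_t, u_tt, \<theta>) \<in> C([0,\<infinity>), H^1 \<times> H^1 \<times> H \<times> H), H^1 = DB, \<parallel>v\<parallel>_1 = \<parallel>B v\<parallel>;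
  the last two equations are tested against \<phi> \<in> D(A) in time-integrated form.\<close>
definition weak_solution ::
  "'h::real_inner set \<Rightarrow> ('h \<Rightarrow> 'h) \<Rightarrow> 'h set \<Rightarrow> ('h \<Rightarrow> 'h) \<Rightarrow> real \<Rightarrow> real \<Rightarrow> real \<Rightarrow> real \<Rightarrow> real \<Rightarrow>
    (real \<Rightarrow> 'h) \<Rightarrow> (real \<Rightarrow> 'h) \<Rightarrow> (real \<Rightarrow> 'h) \<Rightarrow> (real \<Rightarrow> 'h) \<Rightarrow> bool" where
  "weak_solution D A DB B \<alpha> \<beta> \<gamma> \<eta> \<kappa> u ut utt \<theta> \<longleftrightarrow>
     (\<forall>t\<ge>0. u t \<in> DB \<and> ut t \<in> DB) \<and>
     continuous_on {0..} u \<and> continuous_on {0..} (\<lambda>t. B (u t)) \<and>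
     continuous_on {0..} ut \<and> continuous_on {0..} (\<lambda>t. B (ut t)) \<and>
     continuous_on {0..} utt \<and> continuous_on {0..} \<theta> \<and>
     (\<forall>t\<ge>0. (u has_vector_derivative ut t) (at t within {0..})) \<and>
     (\<forall>t\<ge>0. (ut has_vector_derivative utt t) (at t within {0..})) \<and>
     (\<forall>\<phi>\<in>D. \<forall>t\<ge>0. utt t \<bullet> \<phi> = utt 0 \<bullet> \<phi> -
         integral {0..t} (\<lambda>s. \<alpha> * (utt s \<bullet> \<phi>) + \<beta> * (ut s \<bullet> A \<phi>) + \<gamma> * (u s \<bullet> A \<phi>)
                               - \<eta> * (\<theta> s \<bullet> A \<phi>))) \<and>
     (\<forall>\<phi>\<in>D. \<forall>t\<ge>0. \<theta> t \<bullet> \<phi> = \<theta> 0 \<bullet> \<phi> -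
         integral {0..t} (\<lambda>s. \<kappa> * (\<theta> s \<bullet> A \<phi>) + \<eta> * (utt s \<bullet> A \<phi>)
                               + \<alpha> * \<eta> * (ut s \<bullet> A \<phi>)))"

definition energy ::
  "('h::real_inner \<Rightarrow> 'h) \<Rightarrow> real \<Rightarrow> (real \<Rightarrow> 'h) \<Rightarrow> (real \<Rightarrow> 'h) \<Rightarrow> (real \<Rightarrow> 'h) \<Rightarrow> (real \<Rightarrow> 'h) \<Rightarrow> real \<Rightarrow> real" where
  "energy B \<alpha> u ut utt \<theta> t =
     (1/2) * ((norm (B (ut t + \<alpha> *\<^sub>R u t)))\<^sup>2 + (norm (utt t + \<alpha> *\<^sub>R ut t))\<^sup>2
              + (norm (B (ut t)))\<^sup>2 + (norm (\<theta> t))\<^sup>2)"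

end

theory Submission
  imports Defs
begin

text \<open>With \<open>w = u\<^sub>t + \<alpha> u\<close>, \<open>v = w\<^sub>t\<close> and \<open>\<mu> = \<gamma> - \<alpha> \<beta>\<close> the energy
  \<open>F = (\<gamma>/\<alpha> \<parallel>w\<parallel>\<^sub>1\<^sup>2 - \<mu>/\<alpha> \<parallel>u\<^sub>t\<parallel>\<^sub>1\<^sup>2 + \<parallel>v\<parallel>\<^sup>2 + \<parallel>\<theta>\<parallel>\<^sup>2) / 2\<close> satisfies
  \<open>F' = \<mu> \<parallel>u\<^sub>t\<parallel>\<^sub>1\<^sup>2 - \<kappa> \<parallel>\<theta>\<parallel>\<^sub>1\<^sup>2\<close>. Eliminating \<open>v\<close> through the heat equation shows that
  \<open>q = u\<^sub>t + A\<^sup>-\<^sup>1 \<theta> / \<eta>\<close> solves \<open>q' + \<alpha> q = (\<alpha> A\<^sup>-\<^sup>1 \<theta> - \<kappa> \<theta>) / \<eta>\<close>, so adding slightly more than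
  \<open>\<mu>/\<alpha> \<parallel>q\<parallel>\<^sub>1\<^sup>2\<close> to \<open>F\<close> yields a coercive functional that dissipates both \<open>\<parallel>q\<parallel>\<^sub>1\<^sup>2\<close> and \<open>\<parallel>\<theta>\<parallel>\<^sub>1\<^sup>2\<close> as
  soon as \<open>\<eta>\<^sup>2 > \<mu> (\<kappa>/\<alpha>\<^sup>2 + 1/(\<kappa> \<lambda>\<^sub>1\<^sup>2))\<close>, which the hypothesis on \<open>\<eta>\<close> implies. Small multiples of
  \<open>\<langle>A\<^sup>-\<^sup>1 \<theta>, v\<rangle> / \<eta>\<close> and \<open>\<langle>v, w\<rangle>\<close> recover the dissipation of \<open>v\<close> and \<open>w\<close>. The computation is carried
  out for the solution regularised by \<open>n (A + n)\<^sup>-\<^sup>1\<close>, with constants independent of \<open>n\<close>, and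
  \<open>n \<rightarrow> \<infinity>\<close> gives the claim for weak solutions.\<close>

subsection \<open>Differentiation on the half line\<close>

text \<open>Testing the first-order remainder \<open>z\<close> against itself reduces the claim to
  the scalar mean value theorem. The intermediate point \<open>r\<close> depends on
  \<open>z\<close>, but norm continuity of \<open>g\<close> makes \<open>g r - g t\<close> small for
  every \<open>r\<close> near \<open>t\<close>, so the weak derivative is a strong one.\<close>

lemma has_vector_derivative_if_inner:
  fixes f g :: "real \<Rightarrow> 'h::real_inner"
  assumes weak: "\<And>\<psi> t. 0 \<le> t \<Longrightarrow> ((\<lambda>t. f t \<bullet> \<psi>) has_real_derivative g t \<bullet> \<psi>) (at t within {0..})"
    and cont: "continuous_on {0..} g" and "0 \<le> t"
  shows "(f has_vector_derivative g t) (at t within {0..})"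
  unfolding has_vector_derivative_def has_derivative_within_alt
proof (intro conjI allI impI)
  show "bounded_linear (\<lambda>x. x *\<^sub>R g t)" by (rule bounded_linear_scaleR_left)
  fix e :: real assume "0 < e"
  then obtain d where d: "0 < d" "\<And>s. 0 \<le> s \<Longrightarrow> dist s t < d \<Longrightarrow> dist (g s) (g t) < e"
    using cont \<open>0 \<le> t\<close> unfolding continuous_on_iff by (metis atLeast_iff)
  show "\<exists>d>0. \<forall>y\<in>{0..}. norm (y - t) < d \<longrightarrow> norm (f y - f t - (y - t) *\<^sub>R g t) \<le> e * norm (y - t)"
  proof (intro exI[of _ d] conjI ballI impI d(1))
    fix s :: real assume s: "s \<in> {0..}" "norm (s - t) < d"
    define z where "z = f s - f t - (s - t) *\<^sub>R g t"
    \<comment> \<open>The linear part is subtracted so that the increment of \<open>h\<close> from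
      \<open>t\<close> to \<open>s\<close> is exactly \<open>z \<bullet> z\<close>, while its
      derivative at \<open>r\<close> is \<open>(g r - g t) \<bullet> z\<close>.\<close>
    define h where "h = (\<lambda>r. f r \<bullet> z - r * (g t \<bullet> z))"
    have der: "(h has_derivative (\<lambda>x. x * ((g r - g t) \<bullet> z))) (at r within S)"
      if "0 \<le> r" "S \<subseteq> {0..}" for r S
    proof -
      have "(h has_real_derivative (g r \<bullet> z - 1 * (g t \<bullet> z))) (at r within {0..})"
        unfolding h_def using that by (intro DERIV_diff weak) (auto intro!: derivative_eq_intros)
      then have "(h has_real_derivative (g r \<bullet> z - 1 * (g t \<bullet> z))) (at r within S)"
        using has_field_derivative_subset that(2) by blast
      moreover have "(*) (g r \<bullet> z - 1 * (g t \<bullet> z)) = (\<lambda>x. x * ((g r - g t) \<bullet> z))"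
        by (auto simp: inner_diff_left algebra_simps)
      ultimately show ?thesis by (simp add: has_field_derivative_def)
    qed
    have "\<exists>r\<ge>0. dist r t < d \<and> h s - h t = (s - t) * ((g r - g t) \<bullet> z)"
    proof (cases s t rule: linorder_cases)
      case less
      have "\<exists>r\<in>{s<..<t}. h t - h s = (t - s) * ((g r - g t) \<bullet> z)"
        using less s by (intro mvt_simple[where f' = "\<lambda>r x. x * ((g r - g t) \<bullet> z)"] der) simp_all
      then obtain r where "r \<in> {s<..<t}" "h t - h s = (t - s) * ((g r - g t) \<bullet> z)" by blast
      with less s show ?thesis by (intro exI[of _ r]) (auto simp: dist_real_def algebra_simps)
    next
      case equal
      then show ?thesis using d \<open>0 \<le> t\<close> by auto
    next
      case greater
      have "\<exists>r\<in>{t<..<s}. h s - h t = (s - t) * ((g r - g t) \<bullet> z)"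
        using greater s \<open>0 \<le> t\<close>
        by (intro mvt_simple[where f' = "\<lambda>r x. x * ((g r - g t) \<bullet> z)"] der) simp_all
      then obtain r where "r \<in> {t<..<s}" "h s - h t = (s - t) * ((g r - g t) \<bullet> z)" by blast
      with greater s \<open>0 \<le> t\<close> show ?thesis by (intro exI[of _ r]) (auto simp: dist_real_def)
    qed
    then obtain r where r: "0 \<le> r" "dist r t < d" "h s - h t = (s - t) * ((g r - g t) \<bullet> z)" by blast
    have "z \<bullet> z = (f s - f t - (s - t) *\<^sub>R g t) \<bullet> z" by (simp only: z_def)
    also have "\<dots> = h s - h t" by (simp add: h_def inner_diff_left algebra_simps)
    finally have "norm z * norm z \<le> \<bar>s - t\<bar> * \<bar>(g r - g t) \<bullet> z\<bar>"
      unfolding r(3) by (simp add: abs_mult[symmetric] flip: power2_norm_eq_inner power2_eq_square)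
    also have "\<dots> \<le> \<bar>s - t\<bar> * (e * norm z)"
    proof -
      have "\<bar>(g r - g t) \<bullet> z\<bar> \<le> norm (g r - g t) * norm z" by (rule Cauchy_Schwarz_ineq2)
      also have "\<dots> \<le> e * norm z"
        using d(2)[OF r(1,2)] by (intro mult_right_mono) (auto simp: dist_norm)
      finally show ?thesis by (intro mult_left_mono) auto
    qed
    finally have *: "norm z * norm z \<le> (e * \<bar>s - t\<bar>) * norm z" by (simp add: algebra_simps)
    have "norm z \<le> e * \<bar>s - t\<bar>"
    proof (cases "norm z = 0")
      case False
      then show ?thesis using * mult_right_le_imp_le by fastforce
    qed (use \<open>0 < e\<close> in auto)
    then show "norm (f s - f t - (s - t) *\<^sub>R g t) \<le> e * norm (s - t)" by (simp add: z_def)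
  qed
qed

lemma has_real_derivative_integral_atLeast:
  fixes f :: "real \<Rightarrow> real"
  assumes "continuous_on {0..} f" "0 \<le> t"
  shows "((\<lambda>t. integral {0..t} f) has_real_derivative f t) (at t within {0..})"
proof -
  have "((\<lambda>t. integral {0..t} f) has_real_derivative f t) (at t within {0..t+1})"
    using assms by (intro integral_has_real_derivative continuous_on_subset[OF assms(1)]) auto
  \<comment> \<open>A derivative within a set sees only a neighbourhood of \<open>t\<close>, and
    there the compact interval and the half line coincide.\<close>
  moreover have "at t within {0..t+1} = at t within {0..}"
    by (rule at_within_nhd[of _ "{t-1<..<t+1}"]) auto
  ultimately show ?thesis by simp
qed

text \<open>Gronwall's inequality in differential form: \<open>L t * exp (\<omega> * t)\<close> has
  nonpositive derivative, so the mean value theorem applies to it.\<close>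

lemma exponential_decay_if_derivative_le:
  fixes L L' :: "real \<Rightarrow> real"
  assumes der: "\<And>t. 0 \<le> t \<Longrightarrow> (L has_real_derivative L' t) (at t within {0..})"
    and le: "\<And>t. 0 \<le> t \<Longrightarrow> L' t \<le> - \<omega> * L t" and "0 \<le> t"
  shows "L t \<le> L 0 * exp (- \<omega> * t)"
proof (cases "t = 0")
  case False
  with \<open>0 \<le> t\<close> have "0 < t" by simp
  define h where "h = (\<lambda>t. L t * exp (\<omega> * t))"
  have "\<exists>s\<in>{0<..<t}. h t - h 0 = (t - 0) * (L' s * exp (\<omega> * s) + L s * (\<omega> * exp (\<omega> * s)))"
  proof (rule mvt_simple[OF \<open>0 < t\<close>])
    fix s assume s: "0 \<le> s" "s \<le> t"
    have "(h has_real_derivative (L' s * exp (\<omega> * s) + exp (\<omega> * s) * \<omega> * L s)) (at s within {0..})"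
      unfolding h_def using s by (auto intro!: derivative_eq_intros der)
    then have "(h has_real_derivative (L' s * exp (\<omega> * s) + exp (\<omega> * s) * \<omega> * L s)) (at s within {0..t})"
      by (rule has_field_derivative_subset) auto
    moreover have "(*) (L' s * exp (\<omega> * s) + exp (\<omega> * s) * \<omega> * L s)
        = (\<lambda>x. x * (L' s * exp (\<omega> * s) + L s * (\<omega> * exp (\<omega> * s))))"
      by (auto simp: algebra_simps)
    ultimately show "(h has_derivative (\<lambda>x. x * (L' s * exp (\<omega> * s) + L s * (\<omega> * exp (\<omega> * s))))) (at s within {0..t})"
      by (simp add: has_field_derivative_def)
  qed
  then obtain s where s: "0 < s" "h t - h 0 = t * ((L' s + \<omega> * L s) * exp (\<omega> * s))"
    by (auto simp: algebra_simps)
  have "t * ((L' s + \<omega> * L s) * exp (\<omega> * s)) \<le> 0"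
    using le[of s] s \<open>0 < t\<close> by (intro mult_nonneg_nonpos mult_nonpos_nonneg) auto
  then have "L t * exp (\<omega> * t) \<le> L 0" using s by (simp add: h_def)
  then have "L t * exp (\<omega> * t) * exp (- \<omega> * t) \<le> L 0 * exp (- \<omega> * t)"
    by (intro mult_right_mono) auto
  then show ?thesis by (simp add: mult.assoc flip: exp_add)
qed auto

subsection \<open>Spectral bound, resolvent and square root\<close>

locale sqrt_operator =
  fixes D DB :: "'h::real_inner set" and A B :: "'h \<Rightarrow> 'h" and lam1 :: real
  assumes sa: "selfadjoint_op D A"
    and A_pos: "\<forall>x\<in>D. x \<noteq> 0 \<longrightarrow> 0 < A x \<bullet> x"
    and spectrum_ge: "\<forall>l\<in>op_spectrum D A. lam1 \<le> l"
    and lam1_pos: "lam1 > 0"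
    and sqrtA: "is_sqrt_op D A DB B"
begin

lemma subspace_D: "subspace D" and linear_on_A: "linear_on D A"
  and dense_D: "closure D = UNIV" and A_sym: "\<And>x y. x \<in> D \<Longrightarrow> y \<in> D \<Longrightarrow> A x \<bullet> y = x \<bullet> A y"
  using sa unfolding selfadjoint_op_def by blast+

lemma subspace_DB: "subspace DB" and linear_on_B: "linear_on DB B"
  and B_sym: "\<And>x y. x \<in> DB \<Longrightarrow> y \<in> DB \<Longrightarrow> B x \<bullet> y = x \<bullet> B y"
  using sqrtA unfolding selfadjoint_op_def is_sqrt_op_def by blast+

lemma D_iff: "x \<in> D \<longleftrightarrow> x \<in> DB \<and> B x \<in> DB"
  and B_B: "x \<in> D \<Longrightarrow> B (B x) = A x"
  using sqrtA unfolding is_sqrt_op_def by blast+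

lemma D_DB: "x \<in> D \<Longrightarrow> x \<in> DB" by (simp add: D_iff)

lemmas D_closed = subspace_add[OF subspace_D] subspace_diff[OF subspace_D] subspace_scale[OF subspace_D]
lemmas DB_closed = subspace_add[OF subspace_DB] subspace_diff[OF subspace_DB] subspace_scale[OF subspace_DB]

lemma A_add: "x \<in> D \<Longrightarrow> y \<in> D \<Longrightarrow> A (x + y) = A x + A y"
  and A_scale: "x \<in> D \<Longrightarrow> A (c *\<^sub>R x) = c *\<^sub>R A x"
  using linear_on_A by (auto simp: linear_on_def)

lemma B_add: "x \<in> DB \<Longrightarrow> y \<in> DB \<Longrightarrow> B (x + y) = B x + B y"
  and B_scale: "x \<in> DB \<Longrightarrow> B (c *\<^sub>R x) = c *\<^sub>R B x"
  using linear_on_B by (auto simp: linear_on_def)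

lemma A_diff: "x \<in> D \<Longrightarrow> y \<in> D \<Longrightarrow> A (x - y) = A x - A y"
  using A_add[of x "(-1) *\<^sub>R y"] A_scale[of y "-1"] D_closed(3)[of y "-1"] by simp

lemma B_diff: "x \<in> DB \<Longrightarrow> y \<in> DB \<Longrightarrow> B (x - y) = B x - B y"
  using B_add[of x "(-1) *\<^sub>R y"] B_scale[of y "-1"] DB_closed(3)[of y "-1"] by simp

lemma inner_A_eq: "x \<in> D \<Longrightarrow> y \<in> DB \<Longrightarrow> A x \<bullet> y = B x \<bullet> B y"
  using B_sym[of "B x" y] by (simp add: B_B D_iff)

lemma resolvent_bij: "l < lam1 \<Longrightarrow> bij_betw (\<lambda>x. A x - l *\<^sub>R x) D UNIV"
  and resolvent_bounded: "l < lam1 \<Longrightarrow> \<exists>C. \<forall>x\<in>D. norm x \<le> C * norm (A x - l *\<^sub>R x)"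
proof -
  assume "l < lam1"
  then have "l \<notin> op_spectrum D A" using spectrum_ge by auto
  then show "bij_betw (\<lambda>x. A x - l *\<^sub>R x) D UNIV" "\<exists>C. \<forall>x\<in>D. norm x \<le> C * norm (A x - l *\<^sub>R x)"
    unfolding op_spectrum_def by blast+
qed

text \<open>The infimum of the numerical range of a nonnegative selfadjoint operator cannot lie in the
  resolvent set: boundedness of the resolvent there would push the quadratic form up by a
  positive amount.\<close>

lemma lam1_le:
  assumes "x \<in> D" shows "lam1 * (norm x)\<^sup>2 \<le> A x \<bullet> x"
proof (rule ccontr)
  assume "\<not> ?thesis"
  then have x: "A x \<bullet> x < lam1 * (x \<bullet> x)" by (simp add: power2_norm_eq_inner)
  then have "x \<noteq> 0" by auto
  \<comment> \<open>Rayleigh quotients; \<open>m\<close> is the bottom of the numerical range. The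
    quotient of the offending \<open>x\<close> puts \<open>m\<close> below \<open>lam1\<close>,
    hence into the resolvent set.\<close>
  define Q where "Q = (\<lambda>x. (A x \<bullet> x) / (x \<bullet> x)) ` (D - {0})"
  define m where "m = Inf Q"
  have "Q \<noteq> {}" using assms \<open>x \<noteq> 0\<close> by (auto simp: Q_def)
  have "bdd_below Q"
    unfolding Q_def by (rule bdd_belowI[of _ 0]) (use A_pos in \<open>force intro: divide_nonneg_nonneg less_imp_le\<close>)
  have m_le: "m * (y \<bullet> y) \<le> A y \<bullet> y" if "y \<in> D" for y
  proof (cases "y = 0")
    case True
    then show ?thesis by simp
  next
    case False
    then have "m \<le> (A y \<bullet> y) / (y \<bullet> y)"
      unfolding m_def by (intro cInf_lower \<open>bdd_below Q\<close>) (auto simp: Q_def that)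
    then show ?thesis using False by (simp add: pos_le_divide_eq)
  qed
  have "m < lam1"
    using m_le[OF assms] x \<open>x \<noteq> 0\<close> by (smt (verit) inner_gt_zero_iff mult_right_mono)
  then obtain C0 where C0: "\<And>x. x \<in> D \<Longrightarrow> norm x \<le> C0 * norm (A x - m *\<^sub>R x)"
    using resolvent_bounded by blast
  define C where "C = max C0 1"
  have "C > 0" by (simp add: C_def)
  have C: "norm x \<le> C * norm (A x - m *\<^sub>R x)" if "x \<in> D" for x
    using C0[OF that] mult_right_mono[of C0 C "norm (A x - m *\<^sub>R x)"] by (auto simp: C_def)
  have "m + 1/C \<le> q" if "q \<in> Q" for q
  proof -
    obtain y where y: "y \<in> D" "y \<noteq> 0" "q = (A y \<bullet> y) / (y \<bullet> y)" using \<open>q \<in> Q\<close> by (auto simp: Q_def)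
    have "y \<in> (\<lambda>x. A x - m *\<^sub>R x) ` D"
      using resolvent_bij[OF \<open>m < lam1\<close>] by (simp add: bij_betw_def)
    then obtain z where z: "z \<in> D" "A z - m *\<^sub>R z = y" by blast
    define N where "N = y \<bullet> y"
    have Az: "A z = y + m *\<^sub>R z" using z by (simp add: algebra_simps)
    have Ay: "A y \<bullet> z = N + m * (z \<bullet> y)"
      using A_sym[OF y(1) z(1)] Az by (simp add: N_def inner_add_right inner_commute)
    have "y \<bullet> z \<le> norm y * norm z" by (rule norm_cauchy_schwarz)
    also have "\<dots> \<le> norm y * (C * norm y)"
      using C[OF z(1)] unfolding z(2) by (intro mult_left_mono) auto
    finally have yz: "y \<bullet> z \<le> C * N" by (simp add: N_def power2_norm_eq_inner[symmetric] power2_eq_square mult_ac)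
    \<comment> \<open>The form of \<open>A - m\<close> is nonnegative at \<open>y - t z\<close>,
      where \<open>(A - m) z = y\<close>. This gives \<open>A y \<bullet> y - m N \<ge> 2 t N -
      t\<^sup>2 (y \<bullet> z)\<close>, and since \<open>y \<bullet> z \<le> C N\<close>, the
      choice \<open>t = 1/C\<close> is optimal and leaves \<open>N / C\<close>.\<close>
    define t where "t = 1/C"
    have "m * ((y - t *\<^sub>R z) \<bullet> (y - t *\<^sub>R z)) \<le> (A y - t *\<^sub>R A z) \<bullet> (y - t *\<^sub>R z)"
      using m_le[of "y - t *\<^sub>R z"] y z by (simp add: A_diff A_scale D_closed)
    then have "m * N + 2 * t * N \<le> A y \<bullet> y + t * (t * (y \<bullet> z))"
      using Ay Az by (simp add: inner_diff_left inner_diff_right inner_add_left inner_add_right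
        inner_commute N_def algebra_simps)
    moreover have "t * (t * (y \<bullet> z)) \<le> t * N"
      using yz \<open>C > 0\<close> by (intro mult_left_mono) (auto simp: t_def field_simps)
    ultimately have "m * N + t * N \<le> A y \<bullet> y" by linarith
    then have "(m + 1/C) * N \<le> A y \<bullet> y" by (simp add: t_def algebra_simps)
    then show ?thesis using y by (simp add: N_def pos_le_divide_eq)
  qed
  then have "m + 1/C \<le> m" unfolding m_def using \<open>Q \<noteq> {}\<close> by (intro cInf_greatest) auto
  with \<open>C > 0\<close> show False by simp
qed

lemma norm_B_ge: "x \<in> D \<Longrightarrow> (norm x)\<^sup>2 \<le> (norm (B x))\<^sup>2 / lam1"
  using lam1_le[of x] lam1_pos inner_A_eq[of x x] D_DB[of x]
  by (simp add: power2_norm_eq_inner field_simps)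

section \<open>The resolvent \<open>(A + n)\<^sup>-\<^sup>1\<close>, the inverse of \<open>A\<close>
  at \<open>n = 0\<close>, and Yosida regularisation\<close>

definition resolvent :: "real \<Rightarrow> 'h \<Rightarrow> 'h" where
  "resolvent n = inv_into D (\<lambda>x. A x + n *\<^sub>R x)"

lemma resolvent_D: "0 \<le> n \<Longrightarrow> resolvent n y \<in> D"
  and resolvent_eq: "0 \<le> n \<Longrightarrow> A (resolvent n y) + n *\<^sub>R resolvent n y = y"
proof -
  assume n: "0 \<le> n"
  \<comment> \<open>The shift \<open>-n\<close> is at most 0 and thus strictly below the spectrum,
    which includes the case \<open>n = 0\<close>.\<close>
  have "bij_betw (\<lambda>x. A x + n *\<^sub>R x) D UNIV" using resolvent_bij[of "-n"] n lam1_pos by simp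
  then have im: "y \<in> (\<lambda>x. A x + n *\<^sub>R x) ` D" by (simp add: bij_betw_def)
  show "resolvent n y \<in> D" unfolding resolvent_def by (rule inv_into_into[OF im])
  show "A (resolvent n y) + n *\<^sub>R resolvent n y = y"
    unfolding resolvent_def using f_inv_into_f[OF im] by simp
qed

lemma resolvent_unique:
  assumes "0 \<le> n" "x \<in> D" "A x + n *\<^sub>R x = y" shows "resolvent n y = x"
proof -
  have "inj_on (\<lambda>x. A x + n *\<^sub>R x) D"
    using resolvent_bij[of "-n"] assms lam1_pos by (simp add: bij_betw_def)
  then show ?thesis unfolding resolvent_def using assms inv_into_f_f by fastforce
qed

text \<open>Pair the resolvent equation with its own solution and use the spectral lower bound
  \<open>lam1_le\<close>.\<close>

lemma norm_resolvent_le: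
  assumes "0 \<le> n" shows "(lam1 + n) * norm (resolvent n y) \<le> norm y"
proof -
  define x where "x = resolvent n y"
  have "(lam1 + n) * (norm x * norm x) \<le> A x \<bullet> x + n * (x \<bullet> x)"
    using lam1_le[of x] resolvent_D[OF assms]
    by (simp add: x_def power2_eq_square power2_norm_eq_inner[symmetric] algebra_simps)
  also have "\<dots> = y \<bullet> x" using resolvent_eq[OF assms, of y]
    by (metis inner_add_left inner_scaleR_left x_def)
  also have "\<dots> \<le> norm y * norm x" by (rule norm_cauchy_schwarz)
  finally have "((lam1 + n) * norm x) * norm x \<le> norm y * norm x" by (simp add: algebra_simps)
  then have "(lam1 + n) * norm x \<le> norm y"
    by (cases "x = 0") (auto intro: mult_right_le_imp_le)
  then show ?thesis by (simp add: x_def)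
qed

lemma linear_resolvent: assumes "0 \<le> n" shows "linear (resolvent n)"
proof (rule linearI)
  note [simp] = resolvent_D[OF assms]
  fix x y
  show "resolvent n (x + y) = resolvent n x + resolvent n y"
    using resolvent_eq[OF assms, of x] resolvent_eq[OF assms, of y]
    by (intro resolvent_unique assms) (auto simp: D_closed A_add scaleR_add_right algebra_simps)
next
  note [simp] = resolvent_D[OF assms]
  fix c x
  have "A (c *\<^sub>R resolvent n x) + n *\<^sub>R c *\<^sub>R resolvent n x = c *\<^sub>R (A (resolvent n x) + n *\<^sub>R resolvent n x)"
    by (simp add: A_scale scaleR_add_right mult.commute)
  then show "resolvent n (c *\<^sub>R x) = c *\<^sub>R resolvent n x"
    by (intro resolvent_unique assms) (auto simp: D_closed resolvent_eq[OF assms])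
qed

lemma bounded_linear_resolvent: assumes "0 \<le> n" shows "bounded_linear (resolvent n)"
proof -
  have "norm (resolvent n y) \<le> norm y * (1 / (lam1 + n))" for y
    using norm_resolvent_le[OF assms, of y] lam1_pos assms by (simp add: field_simps)
  then show ?thesis
    using linear_resolvent[OF assms] by (intro bounded_linear_intro[where K = "1 / (lam1 + n)"])
      (auto simp: linear_add linear_cmul)
qed

text \<open>Boundedness lets \<open>B\<close> be applied to derivatives of regularised curves taken
  in the norm of \<open>H\<close>. It holds because
  \<open>(norm (B x))\<^sup>2 = A x \<bullet> x\<close> is at most \<open>y \<bullet> x\<close> for
  \<open>x = resolvent n y\<close>.\<close>

lemma bounded_linear_B_resolvent: assumes "0 \<le> n" shows "bounded_linear (\<lambda>y. B (resolvent n y))"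
proof (rule bounded_linear_intro[where K = "sqrt (1 / (lam1 + n))"])
  note [simp] = D_DB[OF resolvent_D[OF assms]]
  note lin = linear_resolvent[OF assms]
  fix x y c
  show "B (resolvent n (x + y)) = B (resolvent n x) + B (resolvent n y)"
    by (simp add: linear_add[OF lin] B_add)
  show "B (resolvent n (c *\<^sub>R x)) = c *\<^sub>R B (resolvent n x)"
    by (simp add: linear_cmul[OF lin] B_scale)
  have "(norm (B (resolvent n x)))\<^sup>2 = A (resolvent n x) \<bullet> resolvent n x"
    by (simp add: power2_norm_eq_inner inner_A_eq resolvent_D[OF assms])
  also have "\<dots> \<le> (A (resolvent n x) + n *\<^sub>R resolvent n x) \<bullet> resolvent n x"
    using assms by (simp add: inner_add_left)
  also have "\<dots> = x \<bullet> resolvent n x" by (simp add: resolvent_eq[OF assms])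
  also have "\<dots> \<le> norm x * norm (resolvent n x)" by (rule norm_cauchy_schwarz)
  also have "\<dots> \<le> norm x * (norm x * (1 / (lam1 + n)))"
    using norm_resolvent_le[OF assms, of x] lam1_pos assms
    by (intro mult_left_mono) (auto simp: field_simps)
  also have "\<dots> = (norm x * sqrt (1 / (lam1 + n)))\<^sup>2"
    using lam1_pos assms by (simp add: power_mult_distrib real_sqrt_pow2) (simp add: power2_eq_square)
  finally show "norm (B (resolvent n x)) \<le> norm x * sqrt (1 / (lam1 + n))"
    using lam1_pos assms by (auto dest: power2_le_imp_le)
qed

lemma resolvent_sym: assumes "0 \<le> n" shows "resolvent n x \<bullet> y = x \<bullet> resolvent n y"
proof -
  have "resolvent n x \<bullet> (A (resolvent n y) + n *\<^sub>R resolvent n y)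
      = (A (resolvent n x) + n *\<^sub>R resolvent n x) \<bullet> resolvent n y"
    using A_sym[OF resolvent_D[OF assms] resolvent_D[OF assms], of x y]
    by (simp add: inner_add_left inner_add_right)
  then show ?thesis by (simp add: resolvent_eq[OF assms])
qed

text \<open>For \<open>y = resolvent n x\<close> the equation gives \<open>A y = x - n y\<close>,
  which stays in \<open>DB\<close>; hence \<open>B y\<close> lies in \<open>D\<close> and solves the
  resolvent equation with right-hand side \<open>B x\<close>. Commutation turns regularised energy
  norms into regularisations of fixed vectors of \<open>H\<close>.\<close>

lemma B_resolvent_commute:
  assumes "0 \<le> n" "x \<in> DB" shows "B (resolvent n x) = resolvent n (B x)"
proof -
  define y where "y = resolvent n x"
  have y: "y \<in> D" and A_y: "A y = x - n *\<^sub>R y"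
    using resolvent_D resolvent_eq[of n x] assms by (auto simp: y_def algebra_simps)
  then have "B y \<in> DB" "A y \<in> DB" "y \<in> DB" using assms DB_closed by (auto simp: D_iff)
  then have "B y \<in> D" by (simp add: D_iff B_B y)
  then have "A (B y) = B (A y)" by (metis B_B y)
  also have "\<dots> = B x - n *\<^sub>R B y"
    using assms \<open>y \<in> DB\<close> by (simp add: A_y B_diff B_scale DB_closed)
  finally have "resolvent n (B x) = B y"
    by (intro resolvent_unique assms \<open>B y \<in> D\<close>) (simp add: algebra_simps)
  then show ?thesis by (simp add: y_def)
qed

text \<open>The Yosida maps are contractions, and on \<open>D\<close> their error is
  \<open>resolvent k (A y)\<close>, of order \<open>1/k\<close>. Density of \<open>D\<close> extends
  the convergence to \<open>H\<close> by an \<open>e/3\<close> argument.\<close>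

lemma resolvent_tendsto: "(\<lambda>k. real k *\<^sub>R resolvent (real k) x) \<longlonglongrightarrow> x"
proof (rule LIMSEQ_I)
  fix e :: real assume "0 < e"
  define J where "J k x = real k *\<^sub>R resolvent (real k) x" for k x
  have J_le: "norm (J k x) \<le> norm x" for k x
  proof -
    have "real k * norm (resolvent k x) \<le> (lam1 + real k) * norm (resolvent k x)"
      using lam1_pos by (intro mult_right_mono) auto
    then show ?thesis using norm_resolvent_le[of "real k" x] by (simp add: J_def)
  qed
  have J_diff: "J k (x - y) = J k x - J k y" for k x y
    by (simp add: J_def linear_diff[OF linear_resolvent] scaleR_diff_right)
  obtain y where y: "y \<in> D" "dist y x < e/3"
    using dense_D \<open>0 < e\<close> closure_approachable[of x D] by (metis UNIV_I divide_pos_pos zero_less_numeral)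
  have y_J: "real k * norm (y - J k y) \<le> norm (A y)" for k
  proof -
    have "y = resolvent k (A y + real k *\<^sub>R y)"
      by (rule resolvent_unique[symmetric]) (auto simp: y)
    then have "y = resolvent k (A y) + J k y"
      unfolding J_def using linear_resolvent[of "real k"] by (simp add: linear_add linear_cmul)
    then have "y - J k y = resolvent k (A y)" by (metis add_diff_cancel)
    then have "real k * norm (y - J k y) = norm (J k (A y))" by (simp add: J_def)
    then show ?thesis using J_le[of k "A y"] by simp
  qed
  obtain K :: nat where K: "norm (A y) < real K * (e/3)"
    using reals_Archimedean3[of "e/3"] \<open>0 < e\<close> by auto
  show "\<exists>K. \<forall>k\<ge>K. norm (real k *\<^sub>R resolvent (real k) x - x) < e"
  proof (intro exI[of _ K] allI impI)
    fix k assume "K \<le> k"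
    then have "norm (A y) < real k * (e/3)" using \<open>0 < e\<close>
      by (intro less_le_trans[OF K] mult_right_mono) auto
    then have "real k * norm (y - J k y) < real k * (e/3)" using y_J[of k] by simp
    then have "norm (y - J k y) < e/3" by (rule mult_left_less_imp_less) simp
    moreover have "norm (J k x - J k y) < e/3"
      using J_le[of k "x - y"] y(2) by (simp add: J_diff dist_norm norm_minus_commute)
    moreover have "norm (y - x) < e/3" using y(2) by (simp add: dist_norm)
    ultimately have "norm ((J k x - J k y) - (y - J k y) + (y - x)) < e"
      using norm_triangle_ineq[of "(J k x - J k y) - (y - J k y)" "y - x"]
        norm_triangle_ineq4[of "J k x - J k y" "y - J k y"] by linarith
    then have "norm (J k x - x) < e" by simp
    then show "norm (real k *\<^sub>R resolvent (real k) x - x) < e" by (simp add: J_def)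
  qed
qed

end

subsection \<open>The Lyapunov functional\<close>

lemma norm_add_power2_le:
  fixes x y :: "'a::real_inner"
  shows "(norm (x + y))\<^sup>2 \<le> 2 * (norm x)\<^sup>2 + 2 * (norm y)\<^sup>2"
proof -
  have "(norm (x + y))\<^sup>2 + (norm (x - y))\<^sup>2 = 2 * (norm x)\<^sup>2 + 2 * (norm y)\<^sup>2"
    by (simp add: power2_norm_eq_inner inner_add_left inner_add_right inner_diff_left inner_diff_right)
  then show ?thesis by (smt (verit) zero_le_power2)
qed

lemma abs_inner_le_Young:
  fixes x y :: "'a::real_inner"
  assumes "0 < d"
  shows "\<bar>x \<bullet> y\<bar> \<le> d / 2 * (norm x)\<^sup>2 + 1 / (2 * d) * (norm y)\<^sup>2"
proof -
  have "0 \<le> (d * norm x - norm y)\<^sup>2" by simp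
  then have "2 * d * (norm x * norm y) \<le> d * (d * (norm x)\<^sup>2) + (norm y)\<^sup>2"
    by (simp add: power2_eq_square algebra_simps)
  then have "norm x * norm y \<le> d / 2 * (norm x)\<^sup>2 + 1 / (2 * d) * (norm y)\<^sup>2"
    using assms by (simp add: field_simps)
  then show ?thesis using Cauchy_Schwarz_ineq2[of x y] by linarith
qed

text \<open>Completing the square in \<open>Q\<close> is exact at weight \<open>2 * a\<close>, where the mixed term in \<open>Q\<close> and
  \<open>\<sigma>\<close> cancels; the small excess \<open>e\<close> produces dissipation of \<open>Q\<close>.\<close>

lemma dissipation_estimate:
  fixes a \<alpha> \<kappa> s b :: real
  assumes "0 \<le> a" "0 < \<alpha>" "0 \<le> b" and s: "a * \<alpha> * (s\<^sup>2 + b) < \<kappa>"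
  obtains e k where "0 < e" "0 < k"
    "\<And>Q T \<sigma> :: 'h::real_inner. (norm \<sigma>)\<^sup>2 \<le> b * (norm T)\<^sup>2 \<Longrightarrow>
       a * \<alpha> * (norm (Q - \<sigma>))\<^sup>2 - \<kappa> * (norm T)\<^sup>2 + (2 * a + e) * \<alpha> * (Q \<bullet> (\<sigma> - Q - s *\<^sub>R T))
         \<le> - k * ((norm Q)\<^sup>2 + (norm T)\<^sup>2)"
proof -
  \<comment> \<open>\<open>d\<close> is the slack in the assumption on \<open>s\<close>;
    \<open>e\<close> is tuned so that the cost \<open>e * \<alpha> * C\<close> of the excess weight
    consumes half of it.\<close>
  define d where "d = \<kappa> - a * \<alpha> * (s\<^sup>2 + b)"
  define C where "C = b + s\<^sup>2 + 1"
  define e where "e = d / (2 * \<alpha> * C)"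
  define k where "k = min (e * \<alpha> / 2) (d / 2)"
  have "0 < d" using s by (simp add: d_def)
  have "0 < C" using assms by (simp add: C_def add_nonneg_pos)
  have "0 < e" using \<open>0 < d\<close> \<open>0 < C\<close> assms by (simp add: e_def)
  have "0 < k" using \<open>0 < d\<close> \<open>0 < e\<close> assms by (simp add: k_def)
  have eC: "e * \<alpha> * C = d / 2" using \<open>0 < C\<close> assms by (simp add: e_def)
  show ?thesis
  proof (rule that[OF \<open>0 < e\<close> \<open>0 < k\<close>])
    fix Q T \<sigma> :: 'h assume \<sigma>: "(norm \<sigma>)\<^sup>2 \<le> b * (norm T)\<^sup>2"
    define Y where "Y = \<sigma> - s *\<^sub>R T"
    have eq: "a * \<alpha> * (norm (Q - \<sigma>))\<^sup>2 - \<kappa> * (norm T)\<^sup>2 + (2 * a + e) * \<alpha> * (Q \<bullet> (\<sigma> - Q - s *\<^sub>R T))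
        = - (a * \<alpha>) * (norm (Q + s *\<^sub>R T))\<^sup>2 + a * \<alpha> * s\<^sup>2 * (norm T)\<^sup>2 + a * \<alpha> * (norm \<sigma>)\<^sup>2
          - \<kappa> * (norm T)\<^sup>2 + e * \<alpha> * (Q \<bullet> Y - (norm Q)\<^sup>2)"
      unfolding Y_def power2_norm_eq_inner by (simp add: inner_add_left inner_add_right
        inner_diff_left inner_diff_right inner_commute algebra_simps power2_eq_square)
    have "(norm Y)\<^sup>2 \<le> 2 * (norm \<sigma>)\<^sup>2 + 2 * (s\<^sup>2 * (norm T)\<^sup>2)"
      using norm_add_power2_le[of \<sigma> "- (s *\<^sub>R T)"] by (simp add: Y_def power_mult_distrib)
    also have "\<dots> \<le> 2 * (C * (norm T)\<^sup>2)"
    proof -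
      have "C * (norm T)\<^sup>2 = b * (norm T)\<^sup>2 + s\<^sup>2 * (norm T)\<^sup>2 + (norm T)\<^sup>2" by (simp add: C_def algebra_simps)
      then show ?thesis using \<sigma> zero_le_power2[of "norm T"] by linarith
    qed
    finally have "Q \<bullet> Y - (norm Q)\<^sup>2 \<le> C * (norm T)\<^sup>2 - 1 / 2 * (norm Q)\<^sup>2"
      using abs_inner_le_Young[of 1 Q Y] by simp
    then have "e * \<alpha> * (Q \<bullet> Y - (norm Q)\<^sup>2) \<le> e * \<alpha> * (C * (norm T)\<^sup>2 - 1 / 2 * (norm Q)\<^sup>2)"
      using \<open>0 < e\<close> assms by (intro mult_left_mono) auto
    also have "\<dots> = d / 2 * (norm T)\<^sup>2 - e * \<alpha> / 2 * (norm Q)\<^sup>2"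
      by (simp add: eC[symmetric] algebra_simps)
    finally have 1: "e * \<alpha> * (Q \<bullet> Y - (norm Q)\<^sup>2) \<le> d / 2 * (norm T)\<^sup>2 - e * \<alpha> / 2 * (norm Q)\<^sup>2" .
    have 2: "a * \<alpha> * (norm \<sigma>)\<^sup>2 \<le> a * \<alpha> * (b * (norm T)\<^sup>2)"
      using \<sigma> assms by (intro mult_left_mono) auto
    have 3: "0 \<le> a * \<alpha> * (norm (Q + s *\<^sub>R T))\<^sup>2" using assms by simp
    have 4: "a * \<alpha> * s\<^sup>2 * (norm T)\<^sup>2 + a * \<alpha> * (b * (norm T)\<^sup>2) - \<kappa> * (norm T)\<^sup>2 = - d * (norm T)\<^sup>2"
      by (simp add: d_def algebra_simps)
    have 5: "k * (norm Q)\<^sup>2 \<le> e * \<alpha> / 2 * (norm Q)\<^sup>2" "k * (norm T)\<^sup>2 \<le> d / 2 * (norm T)\<^sup>2"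
      by (intro mult_right_mono; simp add: k_def)+
    show "a * \<alpha> * (norm (Q - \<sigma>))\<^sup>2 - \<kappa> * (norm T)\<^sup>2 + (2 * a + e) * \<alpha> * (Q \<bullet> (\<sigma> - Q - s *\<^sub>R T))
         \<le> - k * ((norm Q)\<^sup>2 + (norm T)\<^sup>2)"
      unfolding eq using 1 2 3 4 5 by (simp add: algebra_simps)
  qed
qed

text \<open>The identity \<open>2 a |P + \<sigma>|\<^sup>2 - a |P|\<^sup>2 = a |P + 2
  \<sigma>|\<^sup>2 - 2 a |\<sigma>|\<^sup>2\<close> absorbs the negative term. The condition
  \<open>2 * a * b < 1\<close> then leaves part of \<open>\<theta>\<close>, and the excess
  \<open>e\<close> controls \<open>P + \<sigma>\<close> and through it \<open>P\<close>.\<close>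

lemma coercivity_estimate:
  fixes a e b :: real
  assumes "0 \<le> a" "0 < e" "0 \<le> b" and ab: "2 * a * b < 1"
  obtains m where "0 < m"
    "\<And>(P :: 'h::real_inner) (\<sigma> :: 'h) (\<theta> :: 'h). (norm \<sigma>)\<^sup>2 \<le> b * (norm \<theta>)\<^sup>2 \<Longrightarrow>
       m * ((norm P)\<^sup>2 + (norm \<theta>)\<^sup>2) \<le> (norm \<theta>)\<^sup>2 - a * (norm P)\<^sup>2 + (2 * a + e) * (norm (P + \<sigma>))\<^sup>2"
proof -
  define d where "d = 1 - 2 * a * b"
  define m where "m = min (e / 2) (d / (1 + 2 * b))"
  have "0 < d" using ab by (simp add: d_def)
  then have "0 < m" using assms by (simp add: m_def)
  show ?thesis
  proof (rule that[OF \<open>0 < m\<close>])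
    fix P \<sigma> \<theta> :: 'h assume \<sigma>: "(norm \<sigma>)\<^sup>2 \<le> b * (norm \<theta>)\<^sup>2"
    have eq: "(norm \<theta>)\<^sup>2 - a * (norm P)\<^sup>2 + (2 * a + e) * (norm (P + \<sigma>))\<^sup>2
      = (norm \<theta>)\<^sup>2 + a * (norm (P + 2 *\<^sub>R \<sigma>))\<^sup>2 - 2 * a * (norm \<sigma>)\<^sup>2 + e * (norm (P + \<sigma>))\<^sup>2"
      by (simp add: power2_norm_eq_inner inner_add_left inner_add_right inner_commute algebra_simps)
    have 1: "2 * a * (norm \<sigma>)\<^sup>2 \<le> 2 * a * (b * (norm \<theta>)\<^sup>2)"
      using \<sigma> assms by (intro mult_left_mono) auto
    have 2: "0 \<le> a * (norm (P + 2 *\<^sub>R \<sigma>))\<^sup>2" using assms by simp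
    have "(norm P)\<^sup>2 \<le> 2 * (norm (P + \<sigma>))\<^sup>2 + 2 * (norm \<sigma>)\<^sup>2"
      using norm_add_power2_le[of "P + \<sigma>" "- \<sigma>"] by simp
    then have "(norm P)\<^sup>2 + (norm \<theta>)\<^sup>2 \<le> 2 * (norm (P + \<sigma>))\<^sup>2 + (1 + 2 * b) * (norm \<theta>)\<^sup>2"
      using \<sigma> by (simp add: algebra_simps)
    then have "m * ((norm P)\<^sup>2 + (norm \<theta>)\<^sup>2) \<le> m * (2 * (norm (P + \<sigma>))\<^sup>2 + (1 + 2 * b) * (norm \<theta>)\<^sup>2)"
      using \<open>0 < m\<close> by (intro mult_left_mono) auto
    also have "\<dots> = (m * 2) * (norm (P + \<sigma>))\<^sup>2 + (m * (1 + 2 * b)) * (norm \<theta>)\<^sup>2"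
      by (simp add: algebra_simps)
    also have "\<dots> \<le> e * (norm (P + \<sigma>))\<^sup>2 + d * (norm \<theta>)\<^sup>2"
    proof (intro add_mono mult_right_mono)
      have "m \<le> d / (1 + 2 * b)" by (simp add: m_def)
      then show "m * (1 + 2 * b) \<le> d" using assms by (simp add: pos_le_divide_eq)
      have "m \<le> e / 2" unfolding m_def by (rule min.cobounded1)
      then show "m * 2 \<le> e" by simp
    qed auto
    finally show "m * ((norm P)\<^sup>2 + (norm \<theta>)\<^sup>2) \<le> (norm \<theta>)\<^sup>2 - a * (norm P)\<^sup>2 + (2 * a + e) * (norm (P + \<sigma>))\<^sup>2"
      unfolding eq using 1 2 by (simp add: d_def algebra_simps)
  qed
qed

text \<open>The left-hand side is the derivative of
  \<open>\<rho> \<bullet> v + 1 / 4 * (v \<bullet> w)\<close>. The first product yields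
  \<open>- |v|\<^sup>2\<close>, the second \<open>- g / 4 * |W|\<^sup>2\<close> at the price of only
  \<open>1 / 4 * |v|\<^sup>2\<close>; all mixed terms go by Young's inequality into quantities that
  are already dissipated.\<close>

lemma cross_dissipation_estimate:
  fixes a g r \<eta> b b2 :: real
  assumes "0 \<le> a" "0 < g" "0 \<le> b" "0 \<le> b2"
  obtains k K where "0 < k" "0 \<le> K"
    "\<And>(W :: 'h::real_inner) P \<sigma> T (v :: 'h) (\<theta> :: 'h). (norm \<sigma>)\<^sup>2 \<le> b * (norm T)\<^sup>2 \<Longrightarrow> (norm \<theta>)\<^sup>2 \<le> b2 * (norm T)\<^sup>2 \<Longrightarrow>
       - (norm v)\<^sup>2 - r * (\<theta> \<bullet> v) - \<sigma> \<bullet> (g *\<^sub>R W - a *\<^sub>R P) + (norm \<theta>)\<^sup>2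
         + 1 / 4 * ((norm v)\<^sup>2 - (g *\<^sub>R W - a *\<^sub>R P - \<eta> *\<^sub>R T) \<bullet> W)
         \<le> - k * ((norm v)\<^sup>2 + (norm W)\<^sup>2) + K * ((norm (P + \<sigma>))\<^sup>2 + (norm T)\<^sup>2)"
proof -
  \<comment> \<open>Young's inequality leaves the coefficient \<open>3/4 - 1/4 = 1/2\<close> for
    \<open>v\<close> and \<open>g/4 - g/8 = g/8\<close> for \<open>W\<close>;
    \<open>h = 2 / g\<close> is the constant it puts on \<open>Z\<close>.\<close>
  define k where "k = min (1 / 2) (g / 8)"
  define h where "h = 2 / g"
  define K where "K = (r\<^sup>2 + 1) * b2 + h * (2 * (g\<^sup>2 * b) + a\<^sup>2 / 4 * (2 + 2 * b) + \<eta>\<^sup>2 / 4) + a / 2 * (2 + 3 * b)"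
  have "0 < k" "0 \<le> h" using assms by (auto simp: k_def h_def)
  have "0 \<le> K" using assms \<open>0 \<le> h\<close> by (auto simp: K_def intro!: add_nonneg_nonneg mult_nonneg_nonneg)
  show ?thesis
  proof (rule that[OF \<open>0 < k\<close> \<open>0 \<le> K\<close>])
    fix W P \<sigma> T v \<theta> :: 'h
    assume \<sigma>: "(norm \<sigma>)\<^sup>2 \<le> b * (norm T)\<^sup>2" and \<theta>: "(norm \<theta>)\<^sup>2 \<le> b2 * (norm T)\<^sup>2"
    \<comment> \<open>\<open>Z\<close> gathers everything paired with \<open>W\<close>, so that one
      Young inequality handles all these terms.\<close>
    define Z where "Z = (a / 4) *\<^sub>R P + (\<eta> / 4) *\<^sub>R T - g *\<^sub>R \<sigma>"
    define S where "S = (norm (P + \<sigma>))\<^sup>2 + (norm T)\<^sup>2"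
    have TS: "(norm T)\<^sup>2 \<le> S" by (simp add: S_def)
    have "0 \<le> S" by (simp add: S_def)
    have \<sigma>S: "(norm \<sigma>)\<^sup>2 \<le> b * S" using \<sigma> mult_left_mono[OF TS, of b] assms by linarith
    have \<theta>S: "(norm \<theta>)\<^sup>2 \<le> b2 * S" using \<theta> mult_left_mono[OF TS, of b2] assms by linarith
    have "(norm P)\<^sup>2 \<le> 2 * (norm (P + \<sigma>))\<^sup>2 + 2 * (norm \<sigma>)\<^sup>2"
      using norm_add_power2_le[of "P + \<sigma>" "- \<sigma>"] by simp
    moreover have "(norm (P + \<sigma>))\<^sup>2 \<le> S" by (simp add: S_def)
    ultimately have PS: "(norm P)\<^sup>2 \<le> (2 + 2 * b) * S" using \<sigma>S by (simp add: algebra_simps)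
    have eq: "- (norm v)\<^sup>2 - r * (\<theta> \<bullet> v) - \<sigma> \<bullet> (g *\<^sub>R W - a *\<^sub>R P) + (norm \<theta>)\<^sup>2
         + 1 / 4 * ((norm v)\<^sup>2 - (g *\<^sub>R W - a *\<^sub>R P - \<eta> *\<^sub>R T) \<bullet> W)
         = - (3 / 4) * (norm v)\<^sup>2 - (r *\<^sub>R \<theta>) \<bullet> v + (norm \<theta>)\<^sup>2 - g / 4 * (norm W)\<^sup>2 + W \<bullet> Z + a * (\<sigma> \<bullet> P)"
      unfolding Z_def by (simp add: power2_norm_eq_inner inner_add_left inner_add_right
        inner_diff_left inner_diff_right inner_commute algebra_simps)
    have 1: "- ((r *\<^sub>R \<theta>) \<bullet> v) \<le> r\<^sup>2 * (norm \<theta>)\<^sup>2 + 1 / 4 * (norm v)\<^sup>2"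
      using abs_inner_le_Young[of 2 "r *\<^sub>R \<theta>" v] by (simp add: power_mult_distrib)
    have 2: "W \<bullet> Z \<le> g / 8 * (norm W)\<^sup>2 + h * (norm Z)\<^sup>2"
      using abs_inner_le_Young[of "g / 4" W Z] assms by (simp add: h_def)
    have "\<sigma> \<bullet> P \<le> 1 / 2 * (norm \<sigma>)\<^sup>2 + 1 / 2 * (norm P)\<^sup>2"
      using abs_inner_le_Young[of 1 \<sigma> P] by simp
    also have "\<dots> \<le> 1 / 2 * ((2 + 3 * b) * S)" using \<sigma>S PS by (simp add: algebra_simps)
    finally have 3: "a * (\<sigma> \<bullet> P) \<le> a / 2 * (2 + 3 * b) * S"
      using mult_left_mono[OF _ \<open>0 \<le> a\<close>] by fastforce
    have "(norm Z)\<^sup>2 \<le> 2 * (norm ((a / 4) *\<^sub>R P + (\<eta> / 4) *\<^sub>R T))\<^sup>2 + 2 * (g\<^sup>2 * (norm \<sigma>)\<^sup>2)"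
      unfolding Z_def using norm_add_power2_le[of "(a / 4) *\<^sub>R P + (\<eta> / 4) *\<^sub>R T" "- (g *\<^sub>R \<sigma>)"]
      by (simp add: power_mult_distrib)
    moreover have "(norm ((a / 4) *\<^sub>R P + (\<eta> / 4) *\<^sub>R T))\<^sup>2 \<le> a\<^sup>2 / 8 * (norm P)\<^sup>2 + \<eta>\<^sup>2 / 8 * (norm T)\<^sup>2"
      using norm_add_power2_le[of "(a / 4) *\<^sub>R P" "(\<eta> / 4) *\<^sub>R T"]
      by (simp add: power_mult_distrib power_divide)
    moreover have "a\<^sup>2 / 8 * (norm P)\<^sup>2 \<le> a\<^sup>2 / 8 * ((2 + 2 * b) * S)"
      using PS by (intro mult_left_mono) auto
    moreover have "\<eta>\<^sup>2 / 8 * (norm T)\<^sup>2 \<le> \<eta>\<^sup>2 / 8 * S" using TS by (intro mult_left_mono) auto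
    moreover have "g\<^sup>2 * (norm \<sigma>)\<^sup>2 \<le> g\<^sup>2 * (b * S)" using \<sigma>S by (intro mult_left_mono) auto
    ultimately have "(norm Z)\<^sup>2 \<le> 2 * (a\<^sup>2 / 8 * ((2 + 2 * b) * S)) + 2 * (\<eta>\<^sup>2 / 8 * S) + 2 * (g\<^sup>2 * (b * S))"
      by linarith
    also have "\<dots> = (2 * (g\<^sup>2 * b) + a\<^sup>2 / 4 * (2 + 2 * b) + \<eta>\<^sup>2 / 4) * S"
      by (simp add: field_simps)
    finally have 4: "h * (norm Z)\<^sup>2 \<le> h * (2 * (g\<^sup>2 * b) + a\<^sup>2 / 4 * (2 + 2 * b) + \<eta>\<^sup>2 / 4) * S"
      using mult_left_mono[OF _ \<open>0 \<le> h\<close>] by (simp add: mult.assoc)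
    have 5: "(r\<^sup>2 + 1) * (norm \<theta>)\<^sup>2 \<le> (r\<^sup>2 + 1) * (b2 * S)"
      using \<theta>S by (intro mult_left_mono) auto
    have 6: "k * (norm v)\<^sup>2 \<le> 1 / 2 * (norm v)\<^sup>2" "k * (norm W)\<^sup>2 \<le> g / 8 * (norm W)\<^sup>2"
      by (intro mult_right_mono; simp add: k_def)+
    have KS: "K * S = (r\<^sup>2 + 1) * (b2 * S)
        + h * (2 * (g\<^sup>2 * b) + a\<^sup>2 / 4 * (2 + 2 * b) + \<eta>\<^sup>2 / 4) * S + a / 2 * (2 + 3 * b) * S"
      by (simp add: K_def distrib_right mult.assoc)
    have "- (3 / 4) * (norm v)\<^sup>2 - (r *\<^sub>R \<theta>) \<bullet> v + (norm \<theta>)\<^sup>2 - g / 4 * (norm W)\<^sup>2 + W \<bullet> Z + a * (\<sigma> \<bullet> P)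
        \<le> - k * ((norm v)\<^sup>2 + (norm W)\<^sup>2) + K * S"
      using 1 2 3 4 5 6 unfolding KS distrib_left distrib_right mult_minus_left by linarith
    then show "- (norm v)\<^sup>2 - r * (\<theta> \<bullet> v) - \<sigma> \<bullet> (g *\<^sub>R W - a *\<^sub>R P) + (norm \<theta>)\<^sup>2
         + 1 / 4 * ((norm v)\<^sup>2 - (g *\<^sub>R W - a *\<^sub>R P - \<eta> *\<^sub>R T) \<bullet> W)
         \<le> - k * ((norm v)\<^sup>2 + (norm W)\<^sup>2) + K * ((norm (P + \<sigma>))\<^sup>2 + (norm T)\<^sup>2)"
      unfolding eq S_def .
  qed
qed

text \<open>\<open>lyap\<close> is the Lyapunov functional in the variables \<open>W = A\<^sup>1\<^sup>/\<^sup>2 w\<close>, \<open>P = A\<^sup>1\<^sup>/\<^sup>2 u\<^sub>t\<close>,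
  \<open>\<rho> = A\<^sup>-\<^sup>1 \<theta> / \<eta>\<close>, \<open>\<sigma> = A\<^sup>1\<^sup>/\<^sup>2 \<rho>\<close>, \<open>T = A\<^sup>1\<^sup>/\<^sup>2 \<theta>\<close>, with \<open>g = \<gamma>/\<alpha>\<close>, \<open>a = \<mu>/\<alpha>\<close> and
  \<open>s = \<kappa>/(\<alpha> \<eta>)\<close>; \<open>lyap_deriv\<close> is its derivative along solutions.\<close>

definition lyap :: "real \<Rightarrow> real \<Rightarrow> real \<Rightarrow> real \<Rightarrow> 'h::real_inner \<Rightarrow> 'h \<Rightarrow> 'h \<Rightarrow> 'h \<Rightarrow> 'h \<Rightarrow> 'h \<Rightarrow> 'h \<Rightarrow> real" where
  "lyap g a c e W P v \<theta> \<sigma> \<rho> w =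
     1 / 2 * (g * (W \<bullet> W) - a * (P \<bullet> P) + v \<bullet> v + \<theta> \<bullet> \<theta> + c * ((P + \<sigma>) \<bullet> (P + \<sigma>)))
     + e * (\<rho> \<bullet> v + 1 / 4 * (v \<bullet> w))"

definition lyap_deriv :: "real \<Rightarrow> real \<Rightarrow> real \<Rightarrow> real \<Rightarrow> real \<Rightarrow> real \<Rightarrow> real \<Rightarrow> real \<Rightarrow>
    'h::real_inner \<Rightarrow> 'h \<Rightarrow> 'h \<Rightarrow> 'h \<Rightarrow> 'h \<Rightarrow> 'h \<Rightarrow> real" where
  "lyap_deriv g a c e \<alpha> \<kappa> \<eta> s W P v \<theta> \<sigma> T =
     a * \<alpha> * (norm P)\<^sup>2 - \<kappa> * (norm T)\<^sup>2 + c * \<alpha> * ((P + \<sigma>) \<bullet> (\<sigma> - (P + \<sigma>) - s *\<^sub>R T))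
     + e * (- (norm v)\<^sup>2 - \<alpha> * s * (\<theta> \<bullet> v) - \<sigma> \<bullet> (g *\<^sub>R W - a *\<^sub>R P) + (norm \<theta>)\<^sup>2
         + 1 / 4 * ((norm v)\<^sup>2 - (g *\<^sub>R W - a *\<^sub>R P - \<eta> *\<^sub>R T) \<bullet> W))"

text \<open>The constants are fixed in order: first the excess weight \<open>e0\<close> of
  \<open>|P + \<sigma>|\<^sup>2\<close>, which governs dissipation and coercivity, then the small
  factor \<open>e\<close> of the cross terms. They are chosen before any vector, so one set of
  constants serves all regularisations and all times.\<close>

lemma lyapunov_estimates:
  fixes a \<alpha> \<kappa> \<eta> s b b' b2 g :: real
  assumes "0 \<le> a" "0 < g" "0 < \<alpha>" "0 \<le> b" "0 \<le> b'" "0 \<le> b2"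
    and s: "a * \<alpha> * (s\<^sup>2 + b) < \<kappa>" and ab': "2 * a * b' < 1"
  obtains \<omega> m M c e where "0 < \<omega>" "0 < m" "0 < M"
    "\<And>W P v \<theta> \<sigma> \<rho> w T :: 'h::real_inner.
       (norm \<sigma>)\<^sup>2 \<le> b * (norm T)\<^sup>2 \<Longrightarrow> (norm \<sigma>)\<^sup>2 \<le> b' * (norm \<theta>)\<^sup>2 \<Longrightarrow> (norm \<theta>)\<^sup>2 \<le> b2 * (norm T)\<^sup>2 \<Longrightarrow>
       (norm \<rho>)\<^sup>2 \<le> b * (norm \<theta>)\<^sup>2 \<Longrightarrow> (norm w)\<^sup>2 \<le> b2 * (norm W)\<^sup>2 \<Longrightarrow>
       m * ((norm W)\<^sup>2 + (norm v)\<^sup>2 + (norm P)\<^sup>2 + (norm \<theta>)\<^sup>2) \<le> lyap g a c e W P v \<theta> \<sigma> \<rho> w \<and>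
       lyap g a c e W P v \<theta> \<sigma> \<rho> w \<le> M * ((norm W)\<^sup>2 + (norm v)\<^sup>2 + (norm P)\<^sup>2 + (norm \<theta>)\<^sup>2) \<and>
       lyap_deriv g a c e \<alpha> \<kappa> \<eta> s W P v \<theta> \<sigma> T \<le> - \<omega> * lyap g a c e W P v \<theta> \<sigma> \<rho> w"
proof -
  obtain e0 k0 where e0: "0 < e0" and k0: "0 < k0" and diss:
    "\<And>Q T \<sigma> :: 'h. (norm \<sigma>)\<^sup>2 \<le> b * (norm T)\<^sup>2 \<Longrightarrow>
       a * \<alpha> * (norm (Q - \<sigma>))\<^sup>2 - \<kappa> * (norm T)\<^sup>2 + (2 * a + e0) * \<alpha> * (Q \<bullet> (\<sigma> - Q - s *\<^sub>R T))
         \<le> - k0 * ((norm Q)\<^sup>2 + (norm T)\<^sup>2)"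
    using dissipation_estimate[OF \<open>0 \<le> a\<close> \<open>0 < \<alpha>\<close> \<open>0 \<le> b\<close> s] by blast
  obtain m0 where m0: "0 < m0" and coer:
    "\<And>(P :: 'h) (\<sigma> :: 'h) (\<theta> :: 'h). (norm \<sigma>)\<^sup>2 \<le> b' * (norm \<theta>)\<^sup>2 \<Longrightarrow>
       m0 * ((norm P)\<^sup>2 + (norm \<theta>)\<^sup>2) \<le> (norm \<theta>)\<^sup>2 - a * (norm P)\<^sup>2 + (2 * a + e0) * (norm (P + \<sigma>))\<^sup>2"
    using coercivity_estimate[OF \<open>0 \<le> a\<close> e0 \<open>0 \<le> b'\<close> ab'] by blast
  obtain k1 K2 where k1: "0 < k1" and K2: "0 \<le> K2" and cross:
    "\<And>(W :: 'h) P \<sigma> T (v :: 'h) (\<theta> :: 'h). (norm \<sigma>)\<^sup>2 \<le> b * (norm T)\<^sup>2 \<Longrightarrow> (norm \<theta>)\<^sup>2 \<le> b2 * (norm T)\<^sup>2 \<Longrightarrow>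
       - (norm v)\<^sup>2 - \<alpha> * s * (\<theta> \<bullet> v) - \<sigma> \<bullet> (g *\<^sub>R W - a *\<^sub>R P) + (norm \<theta>)\<^sup>2
         + 1 / 4 * ((norm v)\<^sup>2 - (g *\<^sub>R W - a *\<^sub>R P - \<eta> *\<^sub>R T) \<bullet> W)
         \<le> - k1 * ((norm v)\<^sup>2 + (norm W)\<^sup>2) + K2 * ((norm (P + \<sigma>))\<^sup>2 + (norm T)\<^sup>2)"
    using cross_dissipation_estimate[OF \<open>0 \<le> a\<close> \<open>0 < g\<close> \<open>0 \<le> b\<close> \<open>0 \<le> b2\<close>, of "\<alpha> * s" \<eta>] by blast
  define c where "c = 2 * a + e0"
  define m1 where "m1 = min (1 / 2) (min (g / 2) (m0 / 2))"
  define M0 where "M0 = g + 1 + 2 * c + 2 * (c * b')"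
  define K3 where "K3 = 1 + b + b2"
  \<comment> \<open>The first bound keeps the loss \<open>e * K2\<close> below half of the
    dissipation rate \<open>k0\<close>, the second keeps the cross terms below half of the
    coercivity constant \<open>m1\<close>.\<close>
  define e where "e = min (k0 / (2 * (K2 + 1))) (m1 / (2 * K3))"
  \<comment> \<open>The divisor bounds \<open>N\<close> by the dissipated quantities,
    \<open>P\<close> being recovered from \<open>P + \<sigma>\<close> and
    \<open>\<sigma>\<close>.\<close>
  define k5 where "k5 = min (k0 / 2) (e * k1) / (2 + 2 * b + b2)"
  define M where "M = M0 + e * K3"
  define \<omega> where "\<omega> = k5 / M"
  have "0 \<le> c" using e0 assms by (simp add: c_def)
  have "0 < m1" using assms m0 by (simp add: m1_def)
  have "0 < K3" using assms by (simp add: K3_def)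
  have "0 < e" using k0 K2 \<open>0 < m1\<close> \<open>0 < K3\<close> by (simp add: e_def)
  have "0 < k5" using k0 k1 \<open>0 < e\<close> assms by (simp add: k5_def)
  have "0 < M0" using assms \<open>0 \<le> c\<close> by (simp add: M0_def add_pos_nonneg)
  have "0 < M" using \<open>0 < M0\<close> \<open>0 < e\<close> \<open>0 < K3\<close> by (simp add: M_def add_pos_pos)
  have "0 < \<omega>" using \<open>0 < k5\<close> \<open>0 < M\<close> by (simp add: \<omega>_def)
  have eK2: "e * K2 \<le> k0 / 2"
  proof -
    have "e \<le> k0 / (2 * (K2 + 1))" by (simp add: e_def)
    then have "e * (2 * (K2 + 1)) \<le> k0" using K2 by (simp add: pos_le_divide_eq)
    then show ?thesis using \<open>0 < e\<close> by (simp add: algebra_simps)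
  qed
  have eK3: "e * K3 \<le> m1 / 2"
  proof -
    have "e \<le> m1 / (2 * K3)" by (simp add: e_def)
    then have "e * (2 * K3) \<le> m1" using \<open>0 < K3\<close> by (simp add: pos_le_divide_eq)
    then show ?thesis by simp
  qed
  show ?thesis
  proof (rule that[of \<omega> "m1 / 2" M c e])
    show "0 < \<omega>" "0 < m1 / 2" "0 < M" using \<open>0 < \<omega>\<close> \<open>0 < m1\<close> \<open>0 < M\<close> by auto
    fix W P v \<theta> \<sigma> \<rho> w T :: 'h
    assume \<sigma>T: "(norm \<sigma>)\<^sup>2 \<le> b * (norm T)\<^sup>2" and \<sigma>\<theta>: "(norm \<sigma>)\<^sup>2 \<le> b' * (norm \<theta>)\<^sup>2"
      and \<theta>T: "(norm \<theta>)\<^sup>2 \<le> b2 * (norm T)\<^sup>2" and \<rho>: "(norm \<rho>)\<^sup>2 \<le> b * (norm \<theta>)\<^sup>2"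
      and w: "(norm w)\<^sup>2 \<le> b2 * (norm W)\<^sup>2"
    define N where "N = (norm W)\<^sup>2 + (norm v)\<^sup>2 + (norm P)\<^sup>2 + (norm \<theta>)\<^sup>2"
    define S where "S = (norm (P + \<sigma>))\<^sup>2 + (norm T)\<^sup>2"
    define X where "X = \<rho> \<bullet> v + 1 / 4 * (v \<bullet> w)"
    define L0 where "L0 = 1 / 2 * (g * (norm W)\<^sup>2 - a * (norm P)\<^sup>2 + (norm v)\<^sup>2 + (norm \<theta>)\<^sup>2 + c * (norm (P + \<sigma>))\<^sup>2)"
    have L: "lyap g a c e W P v \<theta> \<sigma> \<rho> w = L0 + e * X"
      by (simp add: lyap_def L0_def X_def power2_norm_eq_inner)
    have "0 \<le> N" "0 \<le> S" by (auto simp: N_def S_def)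
    have N_ge: "(norm W)\<^sup>2 \<le> N" "(norm v)\<^sup>2 \<le> N" "(norm P)\<^sup>2 \<le> N" "(norm \<theta>)\<^sup>2 \<le> N"
      by (auto simp: N_def)
    have "\<bar>X\<bar> \<le> K3 * N"
    proof -
      have "(norm \<rho>)\<^sup>2 \<le> b * N" "(norm w)\<^sup>2 \<le> b2 * N"
        using \<rho> w mult_left_mono[OF N_ge(4) \<open>0 \<le> b\<close>] mult_left_mono[OF N_ge(1) \<open>0 \<le> b2\<close>] by linarith+
      moreover have "0 \<le> b * N" "0 \<le> b2 * N" using \<open>0 \<le> N\<close> assms by auto
      ultimately show ?thesis
        using abs_inner_le_Young[of 1 \<rho> v] abs_inner_le_Young[of 1 v w] N_ge(2) \<open>0 \<le> N\<close>
        unfolding X_def K3_def distrib_right by (simp add: abs_le_iff)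
    qed
    then have eX: "\<bar>e * X\<bar> \<le> e * K3 * N"
      using \<open>0 < e\<close> by (simp add: abs_mult mult.assoc)
    have L0_ge: "m1 * N \<le> L0"
    proof -
      have "m1 * (norm v)\<^sup>2 \<le> 1 / 2 * (norm v)\<^sup>2" "m1 * (norm W)\<^sup>2 \<le> g / 2 * (norm W)\<^sup>2"
        "m1 * ((norm P)\<^sup>2 + (norm \<theta>)\<^sup>2) \<le> m0 / 2 * ((norm P)\<^sup>2 + (norm \<theta>)\<^sup>2)"
        by (intro mult_right_mono; simp add: m1_def)+
      then show ?thesis
        using coer[OF \<sigma>\<theta>, of P] by (simp add: L0_def N_def c_def algebra_simps)
    qed
    have L0_le: "L0 \<le> M0 * N"
    proof -
      have "(norm (P + \<sigma>))\<^sup>2 \<le> 2 * (norm P)\<^sup>2 + 2 * (b' * (norm \<theta>)\<^sup>2)"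
        using norm_add_power2_le[of P \<sigma>] \<sigma>\<theta> by linarith
      also have "\<dots> \<le> 2 * N + 2 * (b' * N)"
        using N_ge assms by (intro add_mono mult_left_mono) auto
      finally have "c * (norm (P + \<sigma>))\<^sup>2 \<le> c * (2 * N + 2 * (b' * N))"
        using \<open>0 \<le> c\<close> by (intro mult_left_mono)
      moreover have "g * (norm W)\<^sup>2 \<le> g * N" using N_ge assms by (intro mult_left_mono) auto
      moreover have "0 \<le> a * (norm P)\<^sup>2" "0 \<le> g * N" "0 \<le> c * (2 * N + 2 * (b' * N))"
        using assms \<open>0 \<le> N\<close> \<open>0 \<le> c\<close> by auto
      moreover have "M0 * N = g * N + N + c * (2 * N + 2 * (b' * N))"
        by (simp add: M0_def algebra_simps)
      moreover have "2 * L0 = g * (norm W)\<^sup>2 - a * (norm P)\<^sup>2 + (norm v)\<^sup>2 + (norm \<theta>)\<^sup>2 + c * (norm (P + \<sigma>))\<^sup>2"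
        by (simp add: L0_def)
      ultimately show ?thesis using N_ge by linarith
    qed
    have "e * K3 * N \<le> m1 / 2 * N" using eK3 \<open>0 \<le> N\<close> by (intro mult_right_mono)
    then have lower: "m1 / 2 * N \<le> lyap g a c e W P v \<theta> \<sigma> \<rho> w"
      unfolding L using eX L0_ge by linarith
    have upper: "lyap g a c e W P v \<theta> \<sigma> \<rho> w \<le> M * N"
      unfolding L M_def distrib_right using eX L0_le by linarith
    define D1 where "D1 = - (norm v)\<^sup>2 - \<alpha> * s * (\<theta> \<bullet> v) - \<sigma> \<bullet> (g *\<^sub>R W - a *\<^sub>R P) + (norm \<theta>)\<^sup>2
         + 1 / 4 * ((norm v)\<^sup>2 - (g *\<^sub>R W - a *\<^sub>R P - \<eta> *\<^sub>R T) \<bullet> W)"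
    have "e * D1 \<le> e * (- k1 * ((norm v)\<^sup>2 + (norm W)\<^sup>2) + K2 * S)"
      unfolding D1_def S_def using cross[OF \<sigma>T \<theta>T] \<open>0 < e\<close> by (intro mult_left_mono) auto
    also have "\<dots> = e * K2 * S - e * k1 * ((norm v)\<^sup>2 + (norm W)\<^sup>2)" by (simp add: algebra_simps)
    also have "\<dots> \<le> k0 / 2 * S - e * k1 * ((norm v)\<^sup>2 + (norm W)\<^sup>2)"
      using mult_right_mono[OF eK2 \<open>0 \<le> S\<close>] by simp
    finally have "lyap_deriv g a c e \<alpha> \<kappa> \<eta> s W P v \<theta> \<sigma> T
        \<le> - (k0 / 2) * S - e * k1 * ((norm v)\<^sup>2 + (norm W)\<^sup>2)"
      using diss[OF \<sigma>T, of "P + \<sigma>"] unfolding lyap_deriv_def D1_def[symmetric] c_def[symmetric] S_def[symmetric]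
      by (simp add: algebra_simps)
    also have "\<dots> \<le> - k5 * N"
    proof -
      define q where "q = min (k0 / 2) (e * k1)"
      have "(norm P)\<^sup>2 \<le> 2 * (norm (P + \<sigma>))\<^sup>2 + 2 * (norm \<sigma>)\<^sup>2"
        using norm_add_power2_le[of "P + \<sigma>" "- \<sigma>"] by simp
      then have "N \<le> ((norm v)\<^sup>2 + (norm W)\<^sup>2) + 2 * (norm (P + \<sigma>))\<^sup>2 + 2 * (b * (norm T)\<^sup>2) + b2 * (norm T)\<^sup>2"
        using \<sigma>T \<theta>T by (simp add: N_def)
      also have "\<dots> \<le> (2 + 2 * b + b2) * (((norm v)\<^sup>2 + (norm W)\<^sup>2) + S)"
        using assms by (simp add: S_def distrib_left distrib_right add_nonneg_nonneg)
      finally have "k5 * N \<le> k5 * ((2 + 2 * b + b2) * (((norm v)\<^sup>2 + (norm W)\<^sup>2) + S))"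
        using \<open>0 < k5\<close> by (intro mult_left_mono) auto
      also have "\<dots> = q * ((norm v)\<^sup>2 + (norm W)\<^sup>2) + q * S"
        using assms by (simp add: k5_def q_def[symmetric] distrib_left add_nonneg_nonneg)
      also have "\<dots> \<le> e * k1 * ((norm v)\<^sup>2 + (norm W)\<^sup>2) + k0 / 2 * S"
        using \<open>0 \<le> S\<close> by (intro add_mono mult_right_mono) (auto simp: q_def)
      finally show ?thesis by simp
    qed
    also have "\<dots> \<le> - \<omega> * lyap g a c e W P v \<theta> \<sigma> \<rho> w"
    proof -
      have "\<omega> * lyap g a c e W P v \<theta> \<sigma> \<rho> w \<le> \<omega> * (M * N)"
        using upper \<open>0 < \<omega>\<close> by (intro mult_left_mono) auto
      then show ?thesis using \<open>0 < M\<close> by (simp add: \<omega>_def)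
    qed
    finally show "m1 / 2 * ((norm W)\<^sup>2 + (norm v)\<^sup>2 + (norm P)\<^sup>2 + (norm \<theta>)\<^sup>2) \<le> lyap g a c e W P v \<theta> \<sigma> \<rho> w \<and>
       lyap g a c e W P v \<theta> \<sigma> \<rho> w \<le> M * ((norm W)\<^sup>2 + (norm v)\<^sup>2 + (norm P)\<^sup>2 + (norm \<theta>)\<^sup>2) \<and>
       lyap_deriv g a c e \<alpha> \<kappa> \<eta> s W P v \<theta> \<sigma> T \<le> - \<omega> * lyap g a c e W P v \<theta> \<sigma> \<rho> w"
      using lower upper by (simp add: N_def)
  qed
qed

lemma has_real_derivative_inner:
  fixes f g :: "real \<Rightarrow> 'h::real_inner"
  assumes "(f has_vector_derivative f') (at t within X)" "(g has_vector_derivative g') (at t within X)"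
  shows "((\<lambda>t. f t \<bullet> g t) has_real_derivative (f t \<bullet> g' + f' \<bullet> g t)) (at t within X)"
  using bounded_bilinear.has_vector_derivative[OF bounded_bilinear_inner assms]
  by (simp add: has_real_derivative_iff_has_vector_derivative)

lemma lyap_has_real_derivative:
  fixes W P v \<theta> \<sigma> \<rho> w :: "real \<Rightarrow> 'h::real_inner"
  assumes "(W has_vector_derivative W') (at t within X)" "(P has_vector_derivative P') (at t within X)"
    "(v has_vector_derivative v') (at t within X)" "(\<theta> has_vector_derivative \<theta>') (at t within X)"
    "(\<sigma> has_vector_derivative \<sigma>') (at t within X)" "(\<rho> has_vector_derivative \<rho>') (at t within X)"
    "(w has_vector_derivative w') (at t within X)"
  shows "((\<lambda>t. lyap g a c e (W t) (P t) (v t) (\<theta> t) (\<sigma> t) (\<rho> t) (w t)) has_real_derivative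
    (g * (W t \<bullet> W') - a * (P t \<bullet> P') + v t \<bullet> v' + \<theta> t \<bullet> \<theta>' + c * ((P t + \<sigma> t) \<bullet> (P' + \<sigma>'))
     + e * (\<rho> t \<bullet> v' + \<rho>' \<bullet> v t + 1 / 4 * (v t \<bullet> w' + v' \<bullet> w t)))) (at t within X)"
  unfolding lyap_def
  by (rule derivative_eq_intros has_real_derivative_inner has_vector_derivative_add assms refl)+
     (simp add: inner_commute algebra_simps)

subsection \<open>Regularised weak solutions\<close>

context sqrt_operator
begin

lemma A_resolvent: "0 \<le> n \<Longrightarrow> A (resolvent n y) = y - n *\<^sub>R resolvent n y"
  using resolvent_eq[of n y] by (simp add: algebra_simps)

lemma resolvent_0_A: "x \<in> D \<Longrightarrow> resolvent 0 (A x) = x"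
  by (rule resolvent_unique) auto

text \<open>For arbitrary \<open>\<psi>\<close>, the vector \<open>resolvent n \<psi>\<close> is an
  admissible test vector, and symmetry moves the resolvent onto the solution. As
  \<open>A (resolvent n z) = z - n resolvent n z\<close> is bounded in \<open>z\<close>, the weak
  derivative is norm continuous, hence strong.\<close>

lemma resolvent_weak_evolution:
  assumes n: "0 \<le> n" and cont: "continuous_on {0..} Y" "continuous_on {0..} Z"
    and weak: "\<And>\<phi> t. \<phi> \<in> D \<Longrightarrow> 0 \<le> t \<Longrightarrow>
      X t \<bullet> \<phi> = X 0 \<bullet> \<phi> - integral {0..t} (\<lambda>s. Y s \<bullet> \<phi> + Z s \<bullet> A \<phi>)"
    and "0 \<le> t"
  shows "((\<lambda>t. resolvent n (X t)) has_vector_derivative - (resolvent n (Y t) + A (resolvent n (Z t))))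
    (at t within {0..})"
proof (rule has_vector_derivative_if_inner[OF _ _ \<open>0 \<le> t\<close>])
  show "continuous_on {0..} (\<lambda>t. - (resolvent n (Y t) + A (resolvent n (Z t))))"
    unfolding A_resolvent[OF n]
    by (intro continuous_intros cont bounded_linear.continuous_on[OF bounded_linear_resolvent[OF n]])
  fix \<psi> t assume t: "0 \<le> (t::real)"
  define \<phi> where "\<phi> = resolvent n \<psi>"
  have \<phi>: "\<phi> \<in> D" using resolvent_D n by (simp add: \<phi>_def)
  have "((\<lambda>t. X 0 \<bullet> \<phi> - integral {0..t} (\<lambda>s. Y s \<bullet> \<phi> + Z s \<bullet> A \<phi>)) has_real_derivative
      0 - (Y t \<bullet> \<phi> + Z t \<bullet> A \<phi>)) (at t within {0..})"
    using t by (intro DERIV_diff DERIV_const has_real_derivative_integral_atLeast continuous_intros cont)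
  then have "((\<lambda>t. resolvent n (X t) \<bullet> \<psi>) has_real_derivative 0 - (Y t \<bullet> \<phi> + Z t \<bullet> A \<phi>)) (at t within {0..})"
    unfolding has_field_derivative_def
    by (rule has_derivative_transform[rotated 2])
       (use t in \<open>auto simp: resolvent_sym[OF n] \<phi>_def[symmetric] intro: weak[OF \<phi>]\<close>)
  moreover have "Z t \<bullet> A \<phi> = A (resolvent n (Z t)) \<bullet> \<psi>"
    by (simp add: \<phi>_def A_resolvent[OF n] inner_diff_left inner_diff_right resolvent_sym[OF n])
  ultimately show "((\<lambda>t. resolvent n (X t) \<bullet> \<psi>) has_real_derivative
      - (resolvent n (Y t) + A (resolvent n (Z t))) \<bullet> \<psi>) (at t within {0..})"
    by (simp add: inner_add_left inner_diff_left resolvent_sym[OF n] \<phi>_def)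
qed

text \<open>Here \<open>\<rho> = A\<^sup>-\<^sup>1 \<theta> / \<eta>\<close>. These bounds feed
  \<open>lyapunov_estimates\<close> with constants depending only on \<open>lam1\<close> and
  \<open>\<eta>\<close>; \<open>B \<rho>\<close> is compared with \<open>\<theta>\<close> for
  coercivity and with \<open>B \<theta>\<close> for dissipation.\<close>

lemma resolvent_0_estimates:
  fixes \<eta> :: real and \<theta> :: 'h
  assumes "\<eta> \<noteq> 0" "\<theta> \<in> D"
  defines "\<rho> \<equiv> (1 / \<eta>) *\<^sub>R resolvent 0 \<theta>"
  shows "B \<rho> \<bullet> B \<theta> = (norm \<theta>)\<^sup>2 / \<eta>"
    and "(norm \<theta>)\<^sup>2 \<le> 1 / lam1 * (norm (B \<theta>))\<^sup>2"
    and "(norm \<rho>)\<^sup>2 \<le> 1 / (lam1\<^sup>2 * \<eta>\<^sup>2) * (norm \<theta>)\<^sup>2"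
    and "(norm (B \<rho>))\<^sup>2 \<le> 1 / (lam1 * \<eta>\<^sup>2) * (norm \<theta>)\<^sup>2"
    and "(norm (B \<rho>))\<^sup>2 \<le> 1 / (lam1\<^sup>2 * \<eta>\<^sup>2) * (norm (B \<theta>))\<^sup>2"
proof -
  define r where "r = resolvent 0 \<theta>"
  have r: "r \<in> D" "A r = \<theta>" using resolvent_D[of 0] resolvent_eq[of 0] by (auto simp: r_def)
  have B\<rho>: "B \<rho> = (1 / \<eta>) *\<^sub>R B r" using r by (simp add: \<rho>_def r_def[symmetric] B_scale D_DB)
  show "B \<rho> \<bullet> B \<theta> = (norm \<theta>)\<^sup>2 / \<eta>"
    using inner_A_eq[of r \<theta>] r assms(1,2) unfolding B\<rho> by (simp add: D_DB power2_norm_eq_inner)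
  show 1: "(norm \<theta>)\<^sup>2 \<le> 1 / lam1 * (norm (B \<theta>))\<^sup>2" using norm_B_ge[of \<theta>] assms by simp
  have nr: "norm r \<le> norm \<theta> / lam1"
    using norm_resolvent_le[of 0 \<theta>] lam1_pos by (simp add: r_def field_simps)
  then have "(norm r)\<^sup>2 \<le> (norm \<theta> / lam1)\<^sup>2" by (intro power_mono) auto
  then have "(norm r)\<^sup>2 / \<eta>\<^sup>2 \<le> (norm \<theta> / lam1)\<^sup>2 / \<eta>\<^sup>2" by (intro divide_right_mono) auto
  then show "(norm \<rho>)\<^sup>2 \<le> 1 / (lam1\<^sup>2 * \<eta>\<^sup>2) * (norm \<theta>)\<^sup>2"
    by (simp add: \<rho>_def r_def[symmetric] power_divide)
  have "(norm (B r))\<^sup>2 = \<theta> \<bullet> r"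
    using inner_A_eq[of r r] r by (simp add: D_DB power2_norm_eq_inner)
  also have "\<dots> \<le> norm \<theta> * (norm \<theta> / lam1)"
    using norm_cauchy_schwarz[of \<theta> r] nr mult_left_mono[OF nr, of "norm \<theta>"] by simp
  finally have "(norm (B r))\<^sup>2 / \<eta>\<^sup>2 \<le> norm \<theta> * (norm \<theta> / lam1) / \<eta>\<^sup>2" by (intro divide_right_mono) auto
  then show 2: "(norm (B \<rho>))\<^sup>2 \<le> 1 / (lam1 * \<eta>\<^sup>2) * (norm \<theta>)\<^sup>2"
    by (simp add: B\<rho> power_divide power2_eq_square)
  have "1 / (lam1 * \<eta>\<^sup>2) * (norm \<theta>)\<^sup>2 \<le> 1 / (lam1 * \<eta>\<^sup>2) * (1 / lam1 * (norm (B \<theta>))\<^sup>2)"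
    using 1 lam1_pos by (intro mult_left_mono) auto
  with 2 show "(norm (B \<rho>))\<^sup>2 \<le> 1 / (lam1\<^sup>2 * \<eta>\<^sup>2) * (norm (B \<theta>))\<^sup>2"
    by (simp add: power2_eq_square mult_ac)
qed

text \<open>The resolvent moves every component into \<open>D\<close>, so the weak equations become
  differential equations in \<open>H\<close> and the functional can be differentiated by the product
  rule. What remains is to see the terms containing \<open>V = B v\<close> cancel.\<close>

lemma regularised_lyap_derivative:
  fixes \<alpha> \<beta> \<gamma> \<eta> \<kappa> n c e :: real and u ut utt \<theta> :: "real \<Rightarrow> 'h"
  assumes sol: "weak_solution D A DB B \<alpha> \<beta> \<gamma> \<eta> \<kappa> u ut utt \<theta>"
    and "\<alpha> \<noteq> 0" "\<eta> \<noteq> 0" and n: "0 \<le> n" and t: "0 \<le> t"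
  defines "w \<equiv> \<lambda>t. resolvent n (ut t + \<alpha> *\<^sub>R u t)"
    and "v \<equiv> \<lambda>t. resolvent n (utt t + \<alpha> *\<^sub>R ut t)"
    and "P \<equiv> \<lambda>t. B (resolvent n (ut t))"
    and "\<xi> \<equiv> \<lambda>t. resolvent n (\<theta> t)"
    and "\<rho> \<equiv> \<lambda>t. (1 / \<eta>) *\<^sub>R resolvent 0 (resolvent n (\<theta> t))"
    and "g \<equiv> \<gamma> / \<alpha>" and "a \<equiv> (\<gamma> - \<alpha> * \<beta>) / \<alpha>"
  shows "((\<lambda>t. lyap g a c e (B (w t)) (P t) (v t) (\<xi> t) (B (\<rho> t)) (\<rho> t) (w t)) has_real_derivative
    lyap_deriv g a c e \<alpha> \<kappa> \<eta> (\<kappa> / (\<alpha> * \<eta>)) (B (w t)) (P t) (v t) (\<xi> t) (B (\<rho> t)) (B (\<xi> t)))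
    (at t within {0..})"
proof -
  note sol = sol[unfolded weak_solution_def]
  have cont: "continuous_on {0..} u" "continuous_on {0..} ut" "continuous_on {0..} utt" "continuous_on {0..} \<theta>"
    and u': "\<And>t. 0 \<le> t \<Longrightarrow> (u has_vector_derivative ut t) (at t within {0..})"
    and ut': "\<And>t. 0 \<le> t \<Longrightarrow> (ut has_vector_derivative utt t) (at t within {0..})"
    and eq1: "\<And>\<phi> t. \<phi> \<in> D \<Longrightarrow> 0 \<le> t \<Longrightarrow> utt t \<bullet> \<phi> = utt 0 \<bullet> \<phi> -
         integral {0..t} (\<lambda>s. \<alpha> * (utt s \<bullet> \<phi>) + \<beta> * (ut s \<bullet> A \<phi>) + \<gamma> * (u s \<bullet> A \<phi>) - \<eta> * (\<theta> s \<bullet> A \<phi>))"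
    and eq2: "\<And>\<phi> t. \<phi> \<in> D \<Longrightarrow> 0 \<le> t \<Longrightarrow> \<theta> t \<bullet> \<phi> = \<theta> 0 \<bullet> \<phi> -
         integral {0..t} (\<lambda>s. \<kappa> * (\<theta> s \<bullet> A \<phi>) + \<eta> * (utt s \<bullet> A \<phi>) + \<alpha> * \<eta> * (ut s \<bullet> A \<phi>))"
    using sol by blast+
  define S where "S = resolvent n"
  define R where "R = resolvent 0"
  have lin: "S (x + y) = S x + S y" "S (x - y) = S x - S y" "S (k *\<^sub>R x) = k *\<^sub>R S x" for x y k
    using linear_resolvent[OF n] by (auto simp: S_def linear_add linear_diff linear_cmul)
  have SD[simp]: "S x \<in> D" "S x \<in> DB" for x using resolvent_D[OF n] D_DB by (auto simp: S_def)
  define V where "V = B (v t)"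
  \<comment> \<open>\<open>X\<close> and \<open>Y\<close> collect what stands under \<open>A\<close>
    in the two equations: \<open>v' = - A X\<close> and \<open>\<xi>' = - A Y\<close>.\<close>
  define X where "X = S (\<beta> *\<^sub>R ut t + \<gamma> *\<^sub>R u t - \<eta> *\<^sub>R \<theta> t)"
  define Y where "Y = \<kappa> *\<^sub>R \<xi> t + \<eta> *\<^sub>R v t"
  define T where "T = B (\<xi> t)"
  have mem: "X \<in> D" "Y \<in> D" "w t \<in> D" "v t \<in> D" "\<xi> t \<in> D"
    by (auto simp: X_def Y_def w_def v_def \<xi>_def S_def[symmetric] intro!: D_closed)
  have \<rho>D: "\<rho> t \<in> D" using resolvent_D[of 0] D_closed by (simp add: \<rho>_def)
  \<comment> \<open>This is \<open>\<beta> u\<^sub>t + \<gamma> u = g w - a u\<^sub>t\<close> after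
    regularisation, since \<open>g * \<alpha> = \<gamma>\<close> and
    \<open>g - a = \<beta>\<close>.\<close>
  have BX: "B X = g *\<^sub>R B (w t) - a *\<^sub>R P t - \<eta> *\<^sub>R T"
  proof -
    have "B X = \<beta> *\<^sub>R P t + \<gamma> *\<^sub>R B (S (u t)) - \<eta> *\<^sub>R T"
      by (simp add: X_def P_def T_def \<xi>_def S_def[symmetric] lin B_add B_diff B_scale DB_closed)
    moreover have "B (w t) = P t + \<alpha> *\<^sub>R B (S (u t))"
      by (simp add: w_def P_def S_def[symmetric] lin B_add B_scale DB_closed)
    then have "g *\<^sub>R B (w t) - a *\<^sub>R P t = (g - a) *\<^sub>R P t + (g * \<alpha>) *\<^sub>R B (S (u t))"
      by (simp add: algebra_simps)
    moreover have "g - a = \<beta>" "g * \<alpha> = \<gamma>"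
      unfolding g_def a_def using \<open>\<alpha> \<noteq> 0\<close> by (simp_all add: field_simps)
    ultimately show ?thesis by simp
  qed
  have BY: "B Y = \<kappa> *\<^sub>R T + \<eta> *\<^sub>R V"
    using mem by (simp add: Y_def T_def V_def B_add B_scale DB_closed D_DB)
  have wt': "((\<lambda>t. ut t + \<alpha> *\<^sub>R u t) has_vector_derivative utt t + \<alpha> *\<^sub>R ut t) (at t within {0..})"
    using u'[OF t] ut'[OF t] by (auto intro!: derivative_eq_intros)
  have w': "(w has_vector_derivative v t) (at t within {0..})"
    unfolding w_def v_def by (rule bounded_linear.has_vector_derivative[OF bounded_linear_resolvent[OF n] wt'])
  have W': "((\<lambda>t. B (w t)) has_vector_derivative V) (at t within {0..})"
    unfolding w_def v_def V_def
    by (rule bounded_linear.has_vector_derivative[OF bounded_linear_B_resolvent[OF n] wt'])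
  have P': "(P has_vector_derivative V - \<alpha> *\<^sub>R P t) (at t within {0..})"
  proof -
    have "(P has_vector_derivative B (S (utt t))) (at t within {0..})"
      unfolding P_def S_def
      by (rule bounded_linear.has_vector_derivative[OF bounded_linear_B_resolvent[OF n] ut'[OF t]])
    moreover have "B (S (utt t)) = V - \<alpha> *\<^sub>R P t"
      by (simp add: V_def v_def P_def S_def[symmetric] lin B_add B_scale DB_closed)
    ultimately show ?thesis by simp
  qed
  have v': "(v has_vector_derivative - A X) (at t within {0..})"
  proof -
    have "((\<lambda>t. S (utt t)) has_vector_derivative - (S (\<alpha> *\<^sub>R utt t) + A X)) (at t within {0..})"
      unfolding X_def S_def
    proof (rule resolvent_weak_evolution[OF n])
      fix \<phi> s assume "\<phi> \<in> D" "0 \<le> (s::real)"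
      then show "utt s \<bullet> \<phi> = utt 0 \<bullet> \<phi> - integral {0..s} (\<lambda>s. (\<alpha> *\<^sub>R utt s) \<bullet> \<phi>
          + (\<beta> *\<^sub>R ut s + \<gamma> *\<^sub>R u s - \<eta> *\<^sub>R \<theta> s) \<bullet> A \<phi>)"
        by (subst eq1) (simp_all add: inner_add_left inner_diff_left algebra_simps)
    qed (intro continuous_intros cont t)+
    moreover have "((\<lambda>t. S (ut t)) has_vector_derivative S (utt t)) (at t within {0..})"
      unfolding S_def by (rule bounded_linear.has_vector_derivative[OF bounded_linear_resolvent[OF n] ut'[OF t]])
    \<comment> \<open>The derivative of the \<open>\<alpha> u\<^sub>t\<close> part of
      \<open>v\<close> cancels the damping term \<open>\<alpha> u\<^sub>t\<^sub>t\<close>.\<close>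
    ultimately have "((\<lambda>t. S (utt t) + \<alpha> *\<^sub>R S (ut t)) has_vector_derivative
        - (S (\<alpha> *\<^sub>R utt t) + A X) + \<alpha> *\<^sub>R S (utt t)) (at t within {0..})"
      by (auto intro!: derivative_eq_intros)
    then show ?thesis by (simp add: v_def S_def[symmetric] lin)
  qed
  have \<xi>': "(\<xi> has_vector_derivative - A Y) (at t within {0..})"
  proof -
    have "(\<xi> has_vector_derivative - (resolvent n 0 +
        A (resolvent n (\<kappa> *\<^sub>R \<theta> t + \<eta> *\<^sub>R utt t + (\<alpha> * \<eta>) *\<^sub>R ut t)))) (at t within {0..})"
      unfolding \<xi>_def
    proof (rule resolvent_weak_evolution[OF n])
      fix \<phi> s assume "\<phi> \<in> D" "0 \<le> (s::real)"
      then show "\<theta> s \<bullet> \<phi> = \<theta> 0 \<bullet> \<phi> - integral {0..s} (\<lambda>s. 0 \<bullet> \<phi>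
          + (\<kappa> *\<^sub>R \<theta> s + \<eta> *\<^sub>R utt s + (\<alpha> * \<eta>) *\<^sub>R ut s) \<bullet> A \<phi>)"
        by (subst eq2) (simp_all add: inner_add_left inner_diff_left algebra_simps)
    qed (intro continuous_intros cont t)+
    moreover have "resolvent n 0 = 0" using linear_0[OF linear_resolvent[OF n]] .
    moreover have "resolvent n (\<kappa> *\<^sub>R \<theta> t + \<eta> *\<^sub>R utt t + (\<alpha> * \<eta>) *\<^sub>R ut t) = Y"
      by (simp add: Y_def \<xi>_def v_def S_def[symmetric] lin algebra_simps)
    ultimately show ?thesis by simp
  qed
  \<comment> \<open>Applying the inverse of \<open>A\<close> to the heat equation removes the
    operator: \<open>\<rho>' = - (\<kappa> / \<eta>) \<xi> - v\<close>, which is the source of the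
    dissipation of \<open>v\<close>.\<close>
  have \<rho>': "(\<rho> has_vector_derivative - ((1 / \<eta>) *\<^sub>R Y)) (at t within {0..})"
  proof -
    have "((\<lambda>t. R (\<xi> t)) has_vector_derivative R (- A Y)) (at t within {0..})"
      unfolding R_def by (rule bounded_linear.has_vector_derivative[OF bounded_linear_resolvent \<xi>']) simp
    moreover have "R (- A Y) = - Y"
      using linear_neg[OF linear_resolvent[of 0]] resolvent_0_A[OF mem(2)] by (simp add: R_def)
    moreover have "\<rho> = (\<lambda>t. (1 / \<eta>) *\<^sub>R R (\<xi> t))" by (simp add: \<rho>_def R_def \<xi>_def)
    ultimately show ?thesis by (auto intro!: derivative_eq_intros)
  qed
  have \<sigma>': "((\<lambda>t. B (\<rho> t)) has_vector_derivative - ((1 / \<eta>) *\<^sub>R B Y)) (at t within {0..})"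
  proof -
    have "((\<lambda>t. B (R (\<xi> t))) has_vector_derivative B (R (- A Y))) (at t within {0..})"
      unfolding R_def by (rule bounded_linear.has_vector_derivative[OF bounded_linear_B_resolvent \<xi>']) simp
    moreover have "B (R (- A Y)) = - B Y"
      using linear_neg[OF bounded_linear.linear[OF bounded_linear_B_resolvent[of 0]], of "A Y"]
        resolvent_0_A[OF mem(2)] by (simp add: R_def)
    moreover have "B (\<rho> t) = (1 / \<eta>) *\<^sub>R B (R (\<xi> t))" for t
      using resolvent_D[of 0] D_DB by (simp add: \<rho>_def R_def \<xi>_def B_scale)
    ultimately show ?thesis by (auto intro!: derivative_eq_intros)
  qed
  have inner_A: "x \<bullet> A z = B x \<bullet> B z" if "x \<in> D" "z \<in> D" for x z
    using that inner_A_eq[of z x] D_DB by (simp add: inner_commute)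
  have \<sigma>T: "\<eta> * (B (\<rho> t) \<bullet> T) = (norm (\<xi> t))\<^sup>2"
    using resolvent_0_estimates(1)[OF \<open>\<eta> \<noteq> 0\<close> mem(5)] \<open>\<eta> \<noteq> 0\<close> by (simp add: \<rho>_def T_def \<xi>_def)
  have YV: "(1 / \<eta>) *\<^sub>R Y = (\<kappa> / \<eta>) *\<^sub>R \<xi> t + v t" "(1 / \<eta>) *\<^sub>R B Y = (\<kappa> / \<eta>) *\<^sub>R T + V"
    using \<open>\<eta> \<noteq> 0\<close> unfolding BY by (simp_all add: Y_def algebra_simps)
  define W where "W = B (w t)"
  define p where "p = P t"
  define \<sigma> where "\<sigma> = B (\<rho> t)"
  have s: "\<alpha> * (\<kappa> / (\<alpha> * \<eta>)) = \<kappa> / \<eta>" using \<open>\<alpha> \<noteq> 0\<close> by simp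
  \<comment> \<open>\<open>V\<close> enters \<open>P'\<close> and the derivative of
    \<open>B \<rho>\<close> with opposite signs, so \<open>P + \<sigma>\<close> evolves without
    it.\<close>
  have Q: "c * ((p + \<sigma>) \<bullet> (V - \<alpha> *\<^sub>R p + - ((\<kappa> / \<eta>) *\<^sub>R T + V)))
      = c * \<alpha> * ((p + \<sigma>) \<bullet> (\<sigma> - (p + \<sigma>) - (\<kappa> / (\<alpha> * \<eta>)) *\<^sub>R T))"
  proof -
    have "V - \<alpha> *\<^sub>R p + - ((\<kappa> / \<eta>) *\<^sub>R T + V) = \<alpha> *\<^sub>R (\<sigma> - (p + \<sigma>) - (\<kappa> / (\<alpha> * \<eta>)) *\<^sub>R T)"
      using \<open>\<alpha> \<noteq> 0\<close> by (simp add: scaleR_diff_right s)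
    then show ?thesis by simp
  qed
  have "((\<lambda>t. lyap g a c e (B (w t)) (P t) (v t) (\<xi> t) (B (\<rho> t)) (\<rho> t) (w t)) has_real_derivative
     g * (W \<bullet> V) - a * (p \<bullet> (V - \<alpha> *\<^sub>R p)) + v t \<bullet> - A X + \<xi> t \<bullet> - A Y
     + c * ((p + \<sigma>) \<bullet> (V - \<alpha> *\<^sub>R p + - ((1 / \<eta>) *\<^sub>R B Y)))
     + e * (\<rho> t \<bullet> - A X + - ((1 / \<eta>) *\<^sub>R Y) \<bullet> v t + 1 / 4 * (v t \<bullet> v t + - A X \<bullet> w t))) (at t within {0..})"
    unfolding W_def p_def \<sigma>_def
    by (rule lyap_has_real_derivative[OF W' P' v' \<xi>' \<sigma>' \<rho>' w'])
  moreover have "v t \<bullet> - A X = - (V \<bullet> B X)" "\<xi> t \<bullet> - A Y = - (T \<bullet> B Y)"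
     "\<rho> t \<bullet> - A X = - (\<sigma> \<bullet> B X)" "- A X \<bullet> w t = - (W \<bullet> B X)"
    using inner_A mem \<rho>D by (auto simp: V_def T_def \<sigma>_def W_def inner_commute[of "A X"])
  \<comment> \<open>Energy balance: the elastic terms and the coupling terms
    \<open>\<eta> (V \<bullet> T)\<close> cancel.\<close>
  moreover have "g * (W \<bullet> V) - a * (p \<bullet> (V - \<alpha> *\<^sub>R p)) + - (V \<bullet> B X) + - (T \<bullet> B Y)
     = a * \<alpha> * (norm p)\<^sup>2 - \<kappa> * (norm T)\<^sup>2"
    unfolding BX BY W_def[symmetric] p_def[symmetric] power2_norm_eq_inner
    by (simp add: inner_add_right inner_diff_right inner_commute algebra_simps)
  moreover have "- (\<sigma> \<bullet> B X) + - ((1 / \<eta>) *\<^sub>R Y) \<bullet> v t + 1 / 4 * (v t \<bullet> v t + - (W \<bullet> B X))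
    = - (norm (v t))\<^sup>2 - \<alpha> * (\<kappa> / (\<alpha> * \<eta>)) * (\<xi> t \<bullet> v t) - \<sigma> \<bullet> (g *\<^sub>R W - a *\<^sub>R p) + (norm (\<xi> t))\<^sup>2
         + 1 / 4 * ((norm (v t))\<^sup>2 - (g *\<^sub>R W - a *\<^sub>R p - \<eta> *\<^sub>R T) \<bullet> W)"
    unfolding YV(1) s BX W_def[symmetric] p_def[symmetric] power2_norm_eq_inner
    using \<sigma>T[folded \<sigma>_def, unfolded power2_norm_eq_inner]
    by (simp add: inner_add_left inner_diff_left inner_add_right inner_diff_right inner_commute algebra_simps)
  ultimately show ?thesis
    unfolding lyap_deriv_def YV(2) Q W_def[symmetric] p_def[symmetric] \<sigma>_def[symmetric] T_def[symmetric]
    by simp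
qed

end

section \<open>The threshold condition and removal of the regularisation\<close>

text \<open>In units of \<open>\<kappa> / \<alpha>\<^sup>2\<close> and with
  \<open>y = \<alpha> / (\<kappa> lam1)\<close>, the claim compares \<open>1 + y\<^sup>2\<close>
  with \<open>2 (1 - y + y\<^sup>2)\<close> or with \<open>2\<close>. The first is
  \<open>(1 - y)\<^sup>2 \<ge> 0\<close>, the second holds because \<open>y \<le> 1\<close> in that
  case.\<close>

lemma tfun_ge:
  assumes "0 < \<alpha>" "0 < lam1" "0 < \<kappa>"
  shows "\<kappa> / \<alpha>\<^sup>2 + 1 / (\<kappa> * lam1\<^sup>2) \<le> tfun \<alpha> lam1 \<kappa>"
proof -
  define y where "y = \<alpha> / (\<kappa> * lam1)"
  have eq: "\<kappa> / \<alpha>\<^sup>2 + 1 / (\<kappa> * lam1\<^sup>2) = \<kappa> / \<alpha>\<^sup>2 * (1 + y\<^sup>2)"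
    using assms by (simp add: y_def field_simps power2_eq_square)
  have "0 < y" using assms by (simp add: y_def)
  have "1 + y\<^sup>2 \<le> 2 * (1 - y + y\<^sup>2)" using zero_le_power2[of "1 - y"] by (simp add: power2_eq_square algebra_simps)
  then have 1: "\<kappa> / \<alpha>\<^sup>2 * (1 + y\<^sup>2) \<le> \<kappa> / \<alpha>\<^sup>2 * (2 * (1 - y + y\<^sup>2))"
    using assms by (intro mult_left_mono) auto
  show ?thesis
  proof (cases "\<kappa> < \<alpha> / lam1")
    case True
    then have "tfun \<alpha> lam1 \<kappa> = \<kappa> / \<alpha>\<^sup>2 * (2 * (1 - y + y\<^sup>2))"
      by (simp add: tfun_def y_def power_divide power_mult_distrib)
    with 1 eq show ?thesis by simp
  next
    case False
    then have "y \<le> 1" using assms by (simp add: y_def field_simps)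
    then have "y\<^sup>2 \<le> 1" using \<open>0 < y\<close> by (simp add: power_le_one)
    then have "\<kappa> / \<alpha>\<^sup>2 * (1 + y\<^sup>2) \<le> \<kappa> / \<alpha>\<^sup>2 * 2" using assms by (intro mult_left_mono) auto
    with False eq show ?thesis by (simp add: tfun_def)
  qed
qed

theorem theorem6p3:
  fixes D DB :: "'h::{real_inner, complete_space} set"
    and A B :: "'h \<Rightarrow> 'h"
    and lam1 \<alpha> \<beta> \<gamma> \<eta> \<kappa> :: real
  assumes sa: "selfadjoint_op D A"
    and strictly_pos: "\<forall>x\<in>D. x \<noteq> 0 \<longrightarrow> 0 < A x \<bullet> x"
    and l1_spec: "lam1 \<in> op_spectrum D A"
    and l1_min: "\<forall>l\<in>op_spectrum D A. lam1 \<le> l"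
    and l1_pos: "lam1 > 0"
    and sqrtA: "is_sqrt_op D A DB B"
    and pos: "\<alpha> > 0" "\<beta> > 0" "\<gamma> > 0" "\<kappa> > 0"
    and mu: "\<gamma> - \<alpha> * \<beta> \<ge> 0"
    and eta: "\<eta>\<^sup>2 > tfun \<alpha> lam1 \<kappa> * (\<gamma> - \<alpha> * \<beta>)"
  shows "\<exists>\<omega>>0. \<exists>M\<ge>1. \<forall>u ut utt \<theta>.
           weak_solution D A DB B \<alpha> \<beta> \<gamma> \<eta> \<kappa> u ut utt \<theta> \<longrightarrow>
           (\<forall>t\<ge>0. energy B \<alpha> u ut utt \<theta> t \<le> M * energy B \<alpha> u ut utt \<theta> 0 * exp (- \<omega> * t))"
proof -
  interpret sqrt_operator D DB A B lam1
    by unfold_locales (fact sa strictly_pos l1_min l1_pos sqrtA)+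
  define \<mu> where "\<mu> = \<gamma> - \<alpha> * \<beta>"
  define a where "a = (\<gamma> - \<alpha> * \<beta>) / \<alpha>"
  define g where "g = \<gamma> / \<alpha>"
  define s where "s = \<kappa> / (\<alpha> * \<eta>)"
  have "0 \<le> \<mu>" using mu by (simp add: \<mu>_def)
  have "(\<kappa> / \<alpha>\<^sup>2 + 1 / (\<kappa> * lam1\<^sup>2)) * \<mu> \<le> tfun \<alpha> lam1 \<kappa> * \<mu>"
    using tfun_ge pos l1_pos \<open>0 \<le> \<mu>\<close> by (intro mult_right_mono) auto
  with eta have eta': "(\<kappa> / \<alpha>\<^sup>2 + 1 / (\<kappa> * lam1\<^sup>2)) * \<mu> < \<eta>\<^sup>2" by (simp add: \<mu>_def)
  moreover have "0 \<le> (\<kappa> / \<alpha>\<^sup>2 + 1 / (\<kappa> * lam1\<^sup>2)) * \<mu>" using pos l1_pos \<open>0 \<le> \<mu>\<close> by simp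
  ultimately have eta_pos: "0 < \<eta>\<^sup>2" by linarith
  then have "\<eta> \<noteq> 0" by auto
  \<comment> \<open>With \<open>b = 1 / (lam1\<^sup>2 * \<eta>\<^sup>2)\<close> the dissipation
    condition is exactly the reduced lower bound \<open>eta'\<close> on
    \<open>\<eta>\<^sup>2\<close>.\<close>
  have "a * \<alpha> * (s\<^sup>2 + 1 / (lam1\<^sup>2 * \<eta>\<^sup>2)) = \<kappa> * ((\<kappa> / \<alpha>\<^sup>2 + 1 / (\<kappa> * lam1\<^sup>2)) * \<mu>) / \<eta>\<^sup>2"
    using pos l1_pos \<open>\<eta> \<noteq> 0\<close> by (simp add: a_def \<mu>_def[symmetric] s_def field_simps power2_eq_square)
  also have "\<dots> < \<kappa>" using eta' eta_pos pos by (simp add: pos_divide_less_eq)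
  finally have s: "a * \<alpha> * (s\<^sup>2 + 1 / (lam1\<^sup>2 * \<eta>\<^sup>2)) < \<kappa>" .
  \<comment> \<open>The arithmetic-geometric mean inequality shows that the coercivity condition
    follows from the same bound.\<close>
  have "2 * (1 / (\<alpha> * lam1)) \<le> \<kappa> / \<alpha>\<^sup>2 + 1 / (\<kappa> * lam1\<^sup>2)"
  proof -
    have "0 \<le> \<kappa> * (1 / \<alpha> - 1 / (\<kappa> * lam1))\<^sup>2" using pos by simp
    also have "\<dots> = \<kappa> / \<alpha>\<^sup>2 + 1 / (\<kappa> * lam1\<^sup>2) - 2 * (1 / (\<alpha> * lam1))"
      using pos l1_pos by (simp add: field_simps power2_eq_square)
    finally show ?thesis by simp
  qed
  from mult_right_mono[OF this \<open>0 \<le> \<mu>\<close>] eta' have "2 * (1 / (\<alpha> * lam1)) * \<mu> < \<eta>\<^sup>2" by linarith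
  moreover have "2 * a * (1 / (lam1 * \<eta>\<^sup>2)) = 2 * (1 / (\<alpha> * lam1)) * \<mu> / \<eta>\<^sup>2"
    by (simp add: a_def \<mu>_def)
  ultimately have ab: "2 * a * (1 / (lam1 * \<eta>\<^sup>2)) < 1"
    using eta_pos by (simp only: pos_divide_less_eq mult_1)
  have "0 \<le> a" "0 < g" using mu pos by (auto simp: a_def g_def)
  have b: "0 \<le> 1 / (lam1\<^sup>2 * \<eta>\<^sup>2)" "0 \<le> 1 / (lam1 * \<eta>\<^sup>2)" "0 \<le> 1 / lam1" using l1_pos by auto
  obtain \<omega> m M c e where "0 < \<omega>" "0 < m" "0 < M" and lyap:
    "\<And>W P v \<theta> \<sigma> \<rho> w T :: 'h.
       (norm \<sigma>)\<^sup>2 \<le> 1 / (lam1\<^sup>2 * \<eta>\<^sup>2) * (norm T)\<^sup>2 \<Longrightarrow> (norm \<sigma>)\<^sup>2 \<le> 1 / (lam1 * \<eta>\<^sup>2) * (norm \<theta>)\<^sup>2 \<Longrightarrow>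
       (norm \<theta>)\<^sup>2 \<le> 1 / lam1 * (norm T)\<^sup>2 \<Longrightarrow>
       (norm \<rho>)\<^sup>2 \<le> 1 / (lam1\<^sup>2 * \<eta>\<^sup>2) * (norm \<theta>)\<^sup>2 \<Longrightarrow> (norm w)\<^sup>2 \<le> 1 / lam1 * (norm W)\<^sup>2 \<Longrightarrow>
       m * ((norm W)\<^sup>2 + (norm v)\<^sup>2 + (norm P)\<^sup>2 + (norm \<theta>)\<^sup>2) \<le> lyap g a c e W P v \<theta> \<sigma> \<rho> w \<and>
       lyap g a c e W P v \<theta> \<sigma> \<rho> w \<le> M * ((norm W)\<^sup>2 + (norm v)\<^sup>2 + (norm P)\<^sup>2 + (norm \<theta>)\<^sup>2) \<and>
       lyap_deriv g a c e \<alpha> \<kappa> \<eta> s W P v \<theta> \<sigma> T \<le> - \<omega> * lyap g a c e W P v \<theta> \<sigma> \<rho> w"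
  proof (rule lyapunov_estimates[OF \<open>0 \<le> a\<close> \<open>0 < g\<close> pos(1) b s ab, where ?'h = 'h and \<eta> = \<eta>], goal_cases)
    case (1 \<omega> m M c e)
    show ?thesis by (rule 1(1)[OF 1(2-4)], rule 1(5))
  qed
  have decay: "energy B \<alpha> u ut utt \<theta> t \<le> max 1 (M / m) * energy B \<alpha> u ut utt \<theta> 0 * exp (- \<omega> * t)"
    if sol: "weak_solution D A DB B \<alpha> \<beta> \<gamma> \<eta> \<kappa> u ut utt \<theta>" and "0 \<le> t" for u ut utt \<theta> t
  proof -
    define N where "N n t = (norm (B (resolvent n (ut t + \<alpha> *\<^sub>R u t))))\<^sup>2
      + (norm (resolvent n (utt t + \<alpha> *\<^sub>R ut t)))\<^sup>2
      + (norm (B (resolvent n (ut t))))\<^sup>2 + (norm (resolvent n (\<theta> t)))\<^sup>2" for n t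
    have N_decay: "N n t \<le> M / m * N n 0 * exp (- \<omega> * t)" if n: "0 \<le> n" for n
    proof -
      define L where "L t = lyap g a c e (B (resolvent n (ut t + \<alpha> *\<^sub>R u t))) (B (resolvent n (ut t)))
        (resolvent n (utt t + \<alpha> *\<^sub>R ut t)) (resolvent n (\<theta> t))
        (B ((1 / \<eta>) *\<^sub>R resolvent 0 (resolvent n (\<theta> t)))) ((1 / \<eta>) *\<^sub>R resolvent 0 (resolvent n (\<theta> t)))
        (resolvent n (ut t + \<alpha> *\<^sub>R u t))" for t
      define L' where "L' t = lyap_deriv g a c e \<alpha> \<kappa> \<eta> s (B (resolvent n (ut t + \<alpha> *\<^sub>R u t)))
        (B (resolvent n (ut t))) (resolvent n (utt t + \<alpha> *\<^sub>R ut t)) (resolvent n (\<theta> t))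
        (B ((1 / \<eta>) *\<^sub>R resolvent 0 (resolvent n (\<theta> t)))) (B (resolvent n (\<theta> t)))" for t
      \<comment> \<open>Besides the bounds on \<open>\<rho>\<close>, the second estimate is also
        used with the regularised \<open>w\<close> in place of \<open>\<theta>\<close>.\<close>
      have est: "m * N n t \<le> L t \<and> L t \<le> M * N n t \<and> L' t \<le> - \<omega> * L t" for t
        unfolding N_def L_def L'_def
        by (intro lyap resolvent_0_estimates(2-5)[OF \<open>\<eta> \<noteq> 0\<close> resolvent_D[OF n]])
      have "(L has_real_derivative L' t) (at t within {0..})" if "0 \<le> t" for t
        unfolding L_def[abs_def] L'_def g_def a_def s_def
        using pos by (intro regularised_lyap_derivative[OF sol _ \<open>\<eta> \<noteq> 0\<close> n that]) simp
      then have "L t \<le> L 0 * exp (- \<omega> * t)"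
        using est \<open>0 \<le> t\<close> by (rule_tac exponential_decay_if_derivative_le) auto
      also have "\<dots> \<le> M * N n 0 * exp (- \<omega> * t)" using est by (intro mult_right_mono) auto
      finally have "m * N n t \<le> M * N n 0 * exp (- \<omega> * t)" using est[of t] by linarith
      then show ?thesis using \<open>0 < m\<close> by (simp add: field_simps)
    qed
    \<comment> \<open>The resolvents themselves tend to 0. The decay inequality for \<open>N\<close>
      is linear in \<open>N\<close>, so it may be multiplied by \<open>k\<^sup>2\<close>, which
      replaces them by Yosida maps converging to the identity.\<close>
    define J where "J k x = real k *\<^sub>R resolvent (real k) x" for k x
    define G where "G k t = (norm (J k (B (ut t + \<alpha> *\<^sub>R u t))))\<^sup>2 + (norm (J k (utt t + \<alpha> *\<^sub>R ut t)))\<^sup>2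
      + (norm (J k (B (ut t))))\<^sup>2 + (norm (J k (\<theta> t)))\<^sup>2" for k t
    \<comment> \<open>Commuting \<open>B\<close> past the resolvent requires \<open>u t\<close> and
      \<open>ut t\<close> in \<open>DB\<close>, hence \<open>0 \<le> t\<close>; the limit is then
      taken at the fixed vectors \<open>B (ut t)\<close> and
      \<open>B (ut t + \<alpha> *\<^sub>R u t)\<close>.\<close>
    have G_N: "G k t = (real k)\<^sup>2 * N (real k) t" if "0 \<le> t" for k t
    proof -
      have "u t \<in> DB" "ut t \<in> DB" using sol that by (auto simp: weak_solution_def)
      then show ?thesis
        by (simp add: G_def N_def J_def B_resolvent_commute DB_closed power_mult_distrib distrib_left)
    qed
    have "G k t \<le> M / m * G k 0 * exp (- \<omega> * t)" for k
    proof -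
      have "(real k)\<^sup>2 * N (real k) t \<le> (real k)\<^sup>2 * (M / m * N (real k) 0 * exp (- \<omega> * t))"
        by (intro mult_left_mono N_decay) auto
      then show ?thesis using G_N[of t k] G_N[of 0 k] \<open>0 \<le> t\<close> by (simp add: mult_ac)
    qed
    moreover have G_lim: "(\<lambda>k. G k t) \<longlonglongrightarrow> 2 * energy B \<alpha> u ut utt \<theta> t" for t
    proof -
      have "(\<lambda>k. J k x) \<longlonglongrightarrow> x" for x unfolding J_def by (rule resolvent_tendsto)
      then have "(\<lambda>k. G k t) \<longlonglongrightarrow> (norm (B (ut t + \<alpha> *\<^sub>R u t)))\<^sup>2 + (norm (utt t + \<alpha> *\<^sub>R ut t))\<^sup>2
          + (norm (B (ut t)))\<^sup>2 + (norm (\<theta> t))\<^sup>2"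
        unfolding G_def by (intro tendsto_add tendsto_power tendsto_norm)
      then show ?thesis by (simp add: energy_def add_divide_distrib)
    qed
    ultimately have "2 * energy B \<alpha> u ut utt \<theta> t \<le> M / m * (2 * energy B \<alpha> u ut utt \<theta> 0) * exp (- \<omega> * t)"
      by (intro LIMSEQ_le[OF G_lim[of t] tendsto_mult_right[OF tendsto_mult_left[OF G_lim[of 0]]]]) auto
    also have "\<dots> \<le> max 1 (M / m) * (2 * energy B \<alpha> u ut utt \<theta> 0) * exp (- \<omega> * t)"
      by (intro mult_right_mono) (auto simp: energy_def)
    finally show ?thesis by simp
  qed
  show ?thesis
    using decay \<open>0 < \<omega>\<close> by (intro exI[of _ \<omega>] conjI exI[of _ "max 1 (M / m)"]) auto
qed

end
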